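(* Let $l\ge 2$ be an integer and let $G$ be a connected graph of order $n\geq 2\kappa'_l+2$ with $l$-edge-connectivity $\kappa'_l\geq l-1$. Then $\rho(G)\leq \rho(H^{\kappa'_l,l}_{n})$, with equality if and only if $G\cong H^{\kappa'_l,l}_{n}$.
   Context: All graphs are simple. For a graph $G$ on at least $l$ vertices, the $l$-edge-connectivity $\kappa'_l(G)$ is the minimum number of edges whose removal leaves a graph with at least $l$ components. $\rho(G)$ denotes the largest eigenvalue of the adjacency matrix of $G$. For integers $a\ge b-1$ and $n$, $H^{a,b}_{n}$ is the graph obtained from $K_{a-b+2}\vee(K_1\cup K_{n-a-1})$ by attaching $b-2$ pendent edges (edges to $b-2$ new vertices of degree one) to one vertex of $K_{a-b+2}$; here $\vee$ denotes join and $\cup$ disjoint union. *)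

theory Defs
  imports "Graph_Theory.Graph_Theory" "Jordan_Normal_Form.Char_Poly"
begin

text \<open>
  A finite simple graph is a \<^locale>\<open>pair_graph\<close>: a finite loopfree digraph with a symmetric arc set
  \<open>parcs G \<subseteq> pverts G \<times> pverts G\<close>, where the edge \<open>{u, v}\<close> is represented by the two arcs \<open>(u, v)\<close>
  and \<open>(v, u)\<close>.
\<close>

definition uedges :: "'a pair_pre_digraph \<Rightarrow> 'a set set" where
  "uedges G = {{u, v} |u v. (u, v) \<in> parcs G}"

definition delete_edges :: "'a pair_pre_digraph \<Rightarrow> 'a set set \<Rightarrow> 'a pair_pre_digraph" where
  "delete_edges G F = G\<lparr>parcs := {(u, v). (u, v) \<in> parcs G \<and> {u, v} \<notin> F}\<rparr>"

text \<open>The strongly connected components of a symmetric digraph are the components of the graph.\<close>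

definition num_components :: "'a pair_pre_digraph \<Rightarrow> nat" where
  "num_components G = card (pre_digraph.sccs (with_proj G))"

text \<open>Meaningful for finite \<open>G\<close> with at least \<open>l\<close> vertices; otherwise no such \<open>F\<close> exists.\<close>

definition edge_connectivity :: "nat \<Rightarrow> 'a pair_pre_digraph \<Rightarrow> nat" where
  "edge_connectivity l G =
    (LEAST k. \<exists>F \<subseteq> uedges G. card F = k \<and> l \<le> num_components (delete_edges G F))"

definition adjacency_matrix :: "'a pair_pre_digraph \<Rightarrow> 'a list \<Rightarrow> real mat" where
  "adjacency_matrix G vs = mat (length vs) (length vs)
    (\<lambda>(i, j). if (vs ! i, vs ! j) \<in> parcs G then 1 else 0)"

text \<open>
  The vertices are listed in an arbitrary order; the eigenvalues do not depend on it
  (see \<open>rho_eq\<close> below). For a simple graph the matrix is real symmetric, so restricting to real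
  eigenvalues loses nothing.
\<close>

definition rho :: "'a pair_pre_digraph \<Rightarrow> real" where
  "rho G = Max {k. eigenvalue
    (adjacency_matrix G (SOME vs. distinct vs \<and> set vs = pverts G)) k}"

definition complete_on :: "'a set \<Rightarrow> 'a pair_pre_digraph" where
  "complete_on A = \<lparr>pverts = A, parcs = {(u, v). u \<in> A \<and> v \<in> A \<and> u \<noteq> v}\<rparr>"

text \<open>Union and join are only used for graphs with disjoint vertex sets.\<close>

definition graph_union ::
    "'a pair_pre_digraph \<Rightarrow> 'a pair_pre_digraph \<Rightarrow> 'a pair_pre_digraph" where
  "graph_union G H = \<lparr>pverts = pverts G \<union> pverts H, parcs = parcs G \<union> parcs H\<rparr>"

definition graph_join ::
    "'a pair_pre_digraph \<Rightarrow> 'a pair_pre_digraph \<Rightarrow> 'a pair_pre_digraph" where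
  "graph_join G H = \<lparr>pverts = pverts G \<union> pverts H,
    parcs = parcs G \<union> parcs H \<union> pverts G \<times> pverts H \<union> pverts H \<times> pverts G\<rparr>"

definition attach_pendants ::
    "'a \<Rightarrow> 'a set \<Rightarrow> 'a pair_pre_digraph \<Rightarrow> 'a pair_pre_digraph" where
  "attach_pendants w P G = \<lparr>pverts = pverts G \<union> P, parcs = parcs G \<union> {w} \<times> P \<union> P \<times> {w}\<rparr>"

text \<open>
  The graph \<open>H\<close> with upper indices \<open>a, b\<close> and order \<open>n\<close>, on the vertex set \<open>{0..<n}\<close>, for
  \<open>2 \<le> b \<le> a + 1\<close> and \<open>a < n\<close>. In this range the blocks below have \<open>a - b + 2\<close>, \<open>1\<close>,
  \<open>n - a - 1\<close> and \<open>b - 2\<close> vertices; the sums are arranged so that no subtraction on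
  \<^typ>\<open>nat\<close> truncates.
\<close>

definition H_graph :: "nat \<Rightarrow> nat \<Rightarrow> nat \<Rightarrow> nat pair_pre_digraph" where
  "H_graph a b n =
    attach_pendants 0 {n + 2 - b..<n}
      (graph_join (complete_on {0..<a + 2 - b})
        (graph_union (complete_on {a + 2 - b})
                     (complete_on {a + 3 - b..<n + 2 - b})))"

lemma eigenvalue_adjacency_matrix_iff:
  assumes "distinct vs"
  shows "eigenvalue (adjacency_matrix G vs) k \<longleftrightarrow>
    (\<exists>f. (\<exists>v\<in>set vs. f v \<noteq> 0) \<and>
         (\<forall>u\<in>set vs. (\<Sum>v\<in>{v\<in>set vs. (u, v) \<in> parcs G}. f v) = k * f u))"
proof -
  let ?n = "length vs"
  have row: "(adjacency_matrix G vs *\<^sub>v x) $ i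
      = (\<Sum>j<?n. if (vs ! i, vs ! j) \<in> parcs G then x $ j else 0)"
    if "x \<in> carrier_vec ?n" "i < ?n" for x i
    using that by (auto simp: adjacency_matrix_def scalar_prod_def lessThan_atLeast0
        intro!: sum.cong)
  have reindex: "(\<Sum>j<?n. if (u, vs ! j) \<in> parcs G then f (vs ! j) else 0)
      = (\<Sum>v\<in>{v\<in>set vs. (u, v) \<in> parcs G}. f v)" for u and f :: "'a \<Rightarrow> real"
  proof -
    have "(\<Sum>j<?n. if (u, vs ! j) \<in> parcs G then f (vs ! j) else 0)
        = (\<Sum>v\<in>set vs. if (u, v) \<in> parcs G then f v else 0)"
      using sum.reindex_bij_betw[OF bij_betw_nth[OF assms refl refl]] .
    then show ?thesis by (simp add: sum.inter_filter)
  qed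
  show ?thesis
  proof
    assume "eigenvalue (adjacency_matrix G vs) k"
    then obtain x where x: "x \<in> carrier_vec ?n" "x \<noteq> 0\<^sub>v ?n"
        "adjacency_matrix G vs *\<^sub>v x = k \<cdot>\<^sub>v x"
      by (auto simp: eigenvalue_def eigenvector_def adjacency_matrix_def)
    define f where "f v = x $ (THE j. j < ?n \<and> vs ! j = v)" for v
    have f: "f (vs ! j) = x $ j" if "j < ?n" for j
    proof -
      have "(THE i. i < ?n \<and> vs ! i = vs ! j) = j"
        using that assms by (auto simp: nth_eq_iff_index_eq)
      then show ?thesis by (simp add: f_def)
    qed
    have "\<exists>j<?n. x $ j \<noteq> 0"
      using x(1,2) by (metis carrier_vecD eq_vecI index_zero_vec)
    then have 1: "\<exists>v\<in>set vs. f v \<noteq> 0"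
      using f by (metis nth_mem)
    have "(\<Sum>v\<in>{v\<in>set vs. (vs ! i, v) \<in> parcs G}. f v) = k * f (vs ! i)" if "i < ?n" for i
    proof -
      have "(\<Sum>j<?n. if (vs ! i, vs ! j) \<in> parcs G then f (vs ! j) else 0)
          = (adjacency_matrix G vs *\<^sub>v x) $ i"
        unfolding row[OF x(1) that] by (intro sum.cong) (auto simp: f)
      also have "\<dots> = k * f (vs ! i)"
        using x that by (simp add: f)
      finally show ?thesis by (simp add: reindex)
    qed
    with 1 show "\<exists>f. (\<exists>v\<in>set vs. f v \<noteq> 0) \<and>
         (\<forall>u\<in>set vs. (\<Sum>v\<in>{v\<in>set vs. (u, v) \<in> parcs G}. f v) = k * f u)"
      by (intro exI[of _ f]) (auto simp: in_set_conv_nth[of _ vs])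
  next
    assume "\<exists>f. (\<exists>v\<in>set vs. f v \<noteq> 0) \<and>
         (\<forall>u\<in>set vs. (\<Sum>v\<in>{v\<in>set vs. (u, v) \<in> parcs G}. f v) = k * f u)"
    then obtain f where f: "\<exists>v\<in>set vs. f v \<noteq> 0"
        "\<And>u. u \<in> set vs \<Longrightarrow> (\<Sum>v\<in>{v\<in>set vs. (u, v) \<in> parcs G}. f v) = k * f u"
      by blast
    define x where "x = vec ?n (\<lambda>j. f (vs ! j))"
    have xc: "x \<in> carrier_vec ?n" by (simp add: x_def)
    have "x \<noteq> 0\<^sub>v ?n"
    proof
      assume "x = 0\<^sub>v ?n"
      then have "f (vs ! j) = 0" if "j < ?n" for j
        using that by (metis index_vec index_zero_vec(1) x_def)
      then show False using f(1) by (metis in_set_conv_nth)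
    qed
    moreover have "adjacency_matrix G vs *\<^sub>v x = k \<cdot>\<^sub>v x"
    proof (rule eq_vecI)
      show "dim_vec (adjacency_matrix G vs *\<^sub>v x) = dim_vec (k \<cdot>\<^sub>v x)"
        by (simp add: adjacency_matrix_def x_def)
      fix i assume "i < dim_vec (k \<cdot>\<^sub>v x)"
      then have i: "i < ?n" by (simp add: x_def)
      have "(adjacency_matrix G vs *\<^sub>v x) $ i
          = (\<Sum>j<?n. if (vs ! i, vs ! j) \<in> parcs G then f (vs ! j) else 0)"
        unfolding row[OF xc i] by (intro sum.cong) (auto simp: x_def)
      also have "\<dots> = k * f (vs ! i)"
        using f(2)[of "vs ! i"] i by (simp add: reindex)
      finally show "(adjacency_matrix G vs *\<^sub>v x) $ i = (k \<cdot>\<^sub>v x) $ i"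
        using i by (simp add: x_def)
    qed
    ultimately show "eigenvalue (adjacency_matrix G vs) k"
      using xc by (auto simp: eigenvalue_def eigenvector_def adjacency_matrix_def)
  qed
qed

lemma rho_eq:
  assumes "distinct vs" "set vs = pverts G"
  shows "rho G = Max {k. eigenvalue (adjacency_matrix G vs) k}"
proof -
  let ?ws = "SOME ws. distinct ws \<and> set ws = pverts G"
  have ws: "distinct ?ws \<and> set ?ws = pverts G"
    using assms by (intro someI[of "\<lambda>ws. distinct ws \<and> set ws = pverts G"]) simp
  then have "eigenvalue (adjacency_matrix G ?ws) k \<longleftrightarrow> eigenvalue (adjacency_matrix G vs) k" for k
    using assms by (simp add: eigenvalue_adjacency_matrix_iff)
  then show ?thesis by (simp add: rho_def)
qed

end

theory Submission
  imports Defs "HOL-Analysis.Function_Topology"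
begin

text \<open>
  Deleting \<open>a\<close> suitable edges splits the vertices into \<open>l\<close> nonempty classes with at most \<open>a\<close> edges
  between them. A connected graph with \<open>m\<close> edges satisfies Hong's bound \<open>\<rho>\<^sup>2 \<le> 2m - n + 1\<close>; if every
  class has at most \<open>n - l\<close> vertices, this gives \<open>\<rho> < n - l\<close>, while the extremal graph contains a
  clique on \<open>n - l + 1\<close> vertices.

  Otherwise one class \<open>B\<close> has \<open>n - l + 1\<close> vertices and the set \<open>S\<close> of the others is met by at most
  \<open>a\<close> edges. Make \<open>B\<close> a clique and let \<open>x\<close> be the Perron vector, with maximum at \<open>w\<close> on \<open>B\<close> and at
  \<open>s\<close> on \<open>S\<close>. The extremal graph is laid on the same vertices: all of \<open>S\<close> is joined to \<open>w\<close>, and \<open>s\<close>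
  is joined to a set \<open>U\<close> containing its neighbours in \<open>B\<close> other than its parent in a breadth-first
  tree rooted at \<open>w\<close>. If \<open>y\<close> is the Perron vector of this graph, the difference of the two spectral
  radii has the sign of the difference of the forms \<open>x\<^sup>T A y\<close>. These are compared edge by edge: the
  edge from each \<open>z\<close> in \<open>S\<close> to its parent is matched with the edge \<open>zw\<close>, and each remaining edge
  with an edge from \<open>s\<close> to \<open>U\<close>.
\<close>

section \<open>Perron vectors\<close>

text \<open>Compactness. The functions vanishing outside \<open>V\<close> with values in
  \<open>{0..1}\<close> form a product of compact sets, and the unit sphere cuts out a closed part
  of it. Maximising over nonnegative functions only yields a nonnegative maximiser at once.\<close>

lemma quadratic_form_attains_max:
  fixes V :: "'a set"
  assumes "finite V" "V \<noteq> {}" "E \<subseteq> V \<times> V"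
  shows "\<exists>f :: 'a \<Rightarrow> real. (\<forall>v. 0 \<le> f v) \<and> (\<Sum>v\<in>V. (f v)\<^sup>2) = 1 \<and>
    (\<forall>g. (\<forall>v\<in>V. 0 \<le> g v) \<longrightarrow> (\<Sum>v\<in>V. (g v)\<^sup>2) = 1 \<longrightarrow>
      (\<Sum>(u, v)\<in>E. g u * g v) \<le> (\<Sum>(u, v)\<in>E. f u * f v))"
proof -
  define K :: "('a \<Rightarrow> real) set" where "K = PiE UNIV (\<lambda>v. if v \<in> V then {0..1} else {0})"
  define S where "S = {f \<in> K. (\<Sum>v\<in>V. (f v)\<^sup>2) = 1}"
  have S_eq: "S = K \<inter> {f. (\<Sum>v\<in>V. (f v)\<^sup>2) = 1}"
    by (auto simp: S_def)
  have "compactin (product_topology (\<lambda>_. euclidean) UNIV) K"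
    unfolding K_def compactin_PiE by (auto simp: compactin_euclidean_iff)
  then have "compact K"
    by (simp add: euclidean_product_topology)
  have coord: "continuous_on A (\<lambda>f :: 'a \<Rightarrow> real. f v)" for A and v
    by (rule continuous_on_subset[OF continuous_on_product_coordinates subset_UNIV])
  have cont: "continuous_on UNIV (\<lambda>f :: 'a \<Rightarrow> real. \<Sum>v\<in>V. (f v)\<^sup>2)"
    by (rule continuous_on_sum, rule continuous_on_power, rule coord)
  have "closed {f :: 'a \<Rightarrow> real. (\<Sum>v\<in>V. (f v)\<^sup>2) = 1}"
    by (rule closed_Collect_eq[OF cont continuous_on_const])
  then have "compact S"
    using compact_Int_closed[OF \<open>compact K\<close>] by (simp only: S_eq)
  moreover have "S \<noteq> {}"
  proof -
    obtain v where v: "v \<in> V" using assms(2) by blast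
    have "(\<Sum>u\<in>V. (if u = v then 1 else 0 :: real)\<^sup>2) = (\<Sum>u\<in>V. if u = v then 1 else 0)"
      by (intro sum.cong) auto
    then have "(\<lambda>u. if u = v then 1 else 0) \<in> S"
      using v assms(1) by (auto simp: S_def K_def PiE_def)
    then show ?thesis by blast
  qed
  moreover have "continuous_on S (\<lambda>f. \<Sum>(u, v)\<in>E. f u * f v)"
    unfolding case_prod_unfold
    by (rule continuous_on_sum, rule continuous_on_mult; rule coord)
  ultimately obtain f where f: "f \<in> S"
    "\<And>g. g \<in> S \<Longrightarrow> (\<Sum>(u, v)\<in>E. g u * g v) \<le> (\<Sum>(u, v)\<in>E. f u * f v)"
    using continuous_attains_sup[of S "\<lambda>f. \<Sum>(u, v)\<in>E. f u * f v"] by blast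
  show ?thesis
  proof (intro exI[of _ f] conjI allI impI)
    show "0 \<le> f v" for v
      using f(1) unfolding S_def K_def PiE_def Pi_def
      by (cases "v \<in> V") (auto dest: spec[of _ v])
    show "(\<Sum>v\<in>V. (f v)\<^sup>2) = 1" using f(1) by (simp add: S_def)
    fix g :: "'a \<Rightarrow> real" assume g: "\<forall>v\<in>V. 0 \<le> g v" "(\<Sum>v\<in>V. (g v)\<^sup>2) = 1"
    \<comment> \<open>Truncation to \<open>V\<close> moves \<open>g\<close> into the compact set and
      leaves the form unchanged, as \<open>E\<close> lies in \<open>V \<times> V\<close>.\<close>
    define h where "h v = (if v \<in> V then g v else 0)" for v
    have "g v \<le> 1" if "v \<in> V" for v
    proof -
      have "(g v)\<^sup>2 \<le> (\<Sum>v\<in>V. (g v)\<^sup>2)"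
        using assms(1) that by (intro member_le_sum) auto
      then show ?thesis using g by (simp add: abs_square_le_1 power2_le_iff_abs_le)
    qed
    then have "h \<in> S" using g by (auto simp: S_def K_def h_def)
    moreover have "(\<Sum>(u, v)\<in>E. h u * h v) = (\<Sum>(u, v)\<in>E. g u * g v)"
      using assms(3) by (intro sum.cong) (auto simp: h_def)
    ultimately show "(\<Sum>(u, v)\<in>E. g u * g v) \<le> (\<Sum>(u, v)\<in>E. f u * f v)"
      using f(2) by metis
  qed
qed

locale sym_graph =
  fixes V :: "'a set" and E :: "('a \<times> 'a) set"
  assumes finite_V: "finite V" and E_sub: "E \<subseteq> V \<times> V" and sym_E: "sym E"
begin

lemma finite_E: "finite E"
  using finite_subset[OF E_sub] finite_V by simp

lemma E_symD: "(u, v) \<in> E \<Longrightarrow> (v, u) \<in> E"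
  using sym_E by (rule symD)

lemma nbrs_sub: "E `` {u} \<subseteq> V"
  using E_sub by auto

lemma finite_nbrs: "finite (E `` {u})"
  using finite_subset[OF nbrs_sub finite_V] .

lemma E_Sigma: "E = Sigma V (\<lambda>u. E `` {u})"
  using E_sub by auto

lemma sum_arcs: "(\<Sum>(u, v)\<in>E. f u v) = (\<Sum>u\<in>V. \<Sum>v\<in>E `` {u}. f u v)"
  by (subst E_Sigma) (simp add: sum.Sigma finite_V finite_nbrs)

lemma sum_arcs_swap: "(\<Sum>(u, v)\<in>E. f u v) = (\<Sum>(u, v)\<in>E. f v u)"
  by (rule sum.reindex_bij_witness[of _ prod.swap prod.swap]) (auto intro: E_symD)

lemma form_eigen_right:
  fixes g h :: "'a \<Rightarrow> real"
  assumes "\<And>u. u \<in> V \<Longrightarrow> (\<Sum>v\<in>E `` {u}. h v) = k * h u"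
  shows "(\<Sum>(u, v)\<in>E. g u * h v) = k * (\<Sum>v\<in>V. g v * h v)"
proof -
  have "(\<Sum>(u, v)\<in>E. g u * h v) = (\<Sum>u\<in>V. g u * (\<Sum>v\<in>E `` {u}. h v))"
    by (simp add: sum_arcs sum_distrib_left)
  also have "\<dots> = (\<Sum>u\<in>V. k * (g u * h u))"
    using assms by (intro sum.cong) auto
  finally show ?thesis by (simp add: sum_distrib_left)
qed

lemma form_eigen_left:
  fixes g h :: "'a \<Rightarrow> real"
  assumes "\<And>u. u \<in> V \<Longrightarrow> (\<Sum>v\<in>E `` {u}. g v) = k * g u"
  shows "(\<Sum>(u, v)\<in>E. g u * h v) = k * (\<Sum>v\<in>V. g v * h v)"
  using form_eigen_right[of g k h] assms by (subst sum_arcs_swap) (simp add: mult_ac)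

text \<open>Rayleigh's principle: the maximiser of the form on the nonnegative part of the sphere is
  an eigenvector, and its value \<open>k\<close> bounds the form at every real vector, since passing
  to absolute values does not decrease the form.\<close>

lemma exists_max_eigenvector:
  assumes "V \<noteq> {}"
  shows "\<exists>(k :: real) f. (\<forall>v. 0 \<le> f v) \<and> (\<exists>v\<in>V. f v \<noteq> 0) \<and>
    (\<forall>u\<in>V. (\<Sum>v\<in>E `` {u}. f v) = k * f u) \<and>
    (\<forall>g. (\<Sum>(u, v)\<in>E. g u * g v) \<le> k * (\<Sum>v\<in>V. (g v)\<^sup>2))"
proof -
  obtain f :: "'a \<Rightarrow> real" where f: "\<And>v. 0 \<le> f v" "(\<Sum>v\<in>V. (f v)\<^sup>2) = 1"
    and fmax: "\<And>g. (\<forall>v\<in>V. 0 \<le> g v) \<Longrightarrow> (\<Sum>v\<in>V. (g v)\<^sup>2) = 1 \<Longrightarrow>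
      (\<Sum>(u, v)\<in>E. g u * g v) \<le> (\<Sum>(u, v)\<in>E. f u * f v)"
    using quadratic_form_attains_max[OF finite_V assms E_sub] by blast
  define k where "k = (\<Sum>(u, v)\<in>E. f u * f v)"
  have ray: "(\<Sum>(u, v)\<in>E. g u * g v) \<le> k * (\<Sum>v\<in>V. (g v)\<^sup>2)" for g :: "'a \<Rightarrow> real"
  proof -
    define c where "c = (\<Sum>v\<in>V. (g v)\<^sup>2)"
    have "c \<ge> 0" by (simp add: c_def sum_nonneg)
    show ?thesis
    proof (cases "c = 0")
      case True
      then have "g v = 0" if "v \<in> V" for v
        using that by (simp add: c_def sum_nonneg_eq_0_iff finite_V)
      then have "(\<Sum>(u, v)\<in>E. g u * g v) = 0"
        using E_sub by (intro sum.neutral) auto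
      then show ?thesis using True by (simp add: c_def)
    next
      case False
      with \<open>c \<ge> 0\<close> have c: "c > 0" by simp
      \<comment> \<open>The normalised absolute value of \<open>g\<close> competes with
        \<open>f\<close>.\<close>
      have "(\<Sum>v\<in>V. (\<bar>g v\<bar> / sqrt c)\<^sup>2) = 1"
        using c by (simp add: power_divide sum_divide_distrib[symmetric] c_def[symmetric])
      then have "(\<Sum>(u, v)\<in>E. (\<bar>g u\<bar> / sqrt c) * (\<bar>g v\<bar> / sqrt c)) \<le> k"
        unfolding k_def using c by (intro fmax) auto
      also have "(\<Sum>(u, v)\<in>E. (\<bar>g u\<bar> / sqrt c) * (\<bar>g v\<bar> / sqrt c)) = (\<Sum>(u, v)\<in>E. \<bar>g u * g v\<bar>) / c"
        using c by (simp add: sum_divide_distrib case_prod_unfold abs_mult)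
      finally have "(\<Sum>(u, v)\<in>E. \<bar>g u * g v\<bar>) \<le> k * c"
        using c by (simp add: field_simps)
      moreover have "(\<Sum>(u, v)\<in>E. g u * g v) \<le> (\<Sum>(u, v)\<in>E. \<bar>g u * g v\<bar>)"
        by (intro sum_mono) auto
      ultimately show ?thesis by (simp add: c_def)
    qed
  qed
  \<comment> \<open>The residual of the eigenvalue equation serves as the direction of a
    perturbation \<open>f + e * h\<close>; the aim is to show that its squared norm \<open>D\<close>
    vanishes.\<close>
  define h where "h u = (\<Sum>v\<in>E `` {u}. f v) - k * f u" for u
  define C where "C = k * (\<Sum>v\<in>V. (h v)\<^sup>2) - (\<Sum>(u, v)\<in>E. h u * h v)"
  define D where "D = (\<Sum>v\<in>V. (h v)\<^sup>2)"
  have hf: "(\<Sum>(u, v)\<in>E. h u * f v) = D + k * (\<Sum>v\<in>V. h v * f v)"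
  proof -
    have "(\<Sum>(u, v)\<in>E. h u * f v) = (\<Sum>u\<in>V. h u * (\<Sum>v\<in>E `` {u}. f v))"
      by (simp add: sum_arcs sum_distrib_left)
    also have "\<dots> = (\<Sum>u\<in>V. (h u)\<^sup>2 + k * (h u * f u))"
      by (intro sum.cong) (auto simp: h_def power2_eq_square algebra_simps)
    finally show ?thesis by (simp add: D_def sum.distrib sum_distrib_left)
  qed
  have fh: "(\<Sum>(u, v)\<in>E. f u * h v) = (\<Sum>(u, v)\<in>E. h u * f v)"
    by (subst sum_arcs_swap) (simp add: mult_ac)
  \<comment> \<open>The Rayleigh bound at \<open>f + e * h\<close>: the zeroth-order terms cancel,
    and the first-order term is \<open>2 * e * D\<close>.\<close>
  have "2 * e * D \<le> e\<^sup>2 * C" for e :: real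
  proof -
    have "(\<Sum>(u, v)\<in>E. (f u + e * h u) * (f v + e * h v))
        = (\<Sum>(u, v)\<in>E. f u * f v) + e * (\<Sum>(u, v)\<in>E. f u * h v) + e * (\<Sum>(u, v)\<in>E. h u * f v)
          + e\<^sup>2 * (\<Sum>(u, v)\<in>E. h u * h v)"
      by (simp add: sum_distrib_left sum.distrib[symmetric] case_prod_unfold algebra_simps
          power2_eq_square)
    moreover have "(\<Sum>v\<in>V. (f v + e * h v)\<^sup>2)
        = (\<Sum>v\<in>V. (f v)\<^sup>2) + 2 * e * (\<Sum>v\<in>V. h v * f v) + e\<^sup>2 * (\<Sum>v\<in>V. (h v)\<^sup>2)"
      by (simp add: sum_distrib_left sum.distrib[symmetric] algebra_simps power2_eq_square)
    moreover note ray[of "\<lambda>v. f v + e * h v"]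
    ultimately show ?thesis
      using f(2) unfolding fh hf k_def[symmetric] C_def by (simp add: algebra_simps)
  qed
  note q = this
  have "D \<le> 0"
  proof (rule ccontr)
    assume "\<not> D \<le> 0"
    then have D: "D > 0" by simp
    \<comment> \<open>This \<open>e\<close> is small enough for the quadratic term to lose against
      the linear one.\<close>
    define e where "e = D / (\<bar>C\<bar> + 1)"
    have e: "e > 0" using D by (simp add: e_def)
    from q[of e] e have "2 * D \<le> e * C" by (simp add: power2_eq_square)
    also have "\<dots> \<le> e * (\<bar>C\<bar> + 1)" using e by (intro mult_left_mono) auto
    also have "\<dots> = D" by (simp add: e_def)
    finally show False using D by simp
  qed
  moreover have "D \<ge> 0" by (simp add: D_def sum_nonneg)
  ultimately have "D = 0" by simp
  then have "h v = 0" if "v \<in> V" for v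
    using that by (simp add: D_def sum_nonneg_eq_0_iff finite_V)
  then have "\<forall>u\<in>V. (\<Sum>v\<in>E `` {u}. f v) = k * f u" by (simp add: h_def)
  moreover have "\<exists>v\<in>V. f v \<noteq> 0" using f(2) by (force intro: ccontr)
  ultimately show ?thesis using f(1) ray by blast
qed

end

text \<open>Finiteness is what makes the \<open>Max\<close> in \<open>rho\<close> a genuine
  maximum.\<close>

lemma eigenvalues_finite:
  assumes "A \<in> carrier_mat n n"
  shows "finite {k :: 'a :: field. eigenvalue A k}"
proof -
  have "char_poly A \<noteq> 0"
    using degree_monic_char_poly[OF assms] by auto
  then show ?thesis
    using poly_roots_finite[of "char_poly A"] by (simp add: eigenvalue_root_char_poly[OF assms])
qed

locale connected_graph = sym_graph +
  assumes V_ne: "V \<noteq> {}" and conn: "\<And>u v. u \<in> V \<Longrightarrow> v \<in> V \<Longrightarrow> (u, v) \<in> E\<^sup>*"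

definition perron :: "'a set \<Rightarrow> ('a \<times> 'a) set \<Rightarrow> real \<Rightarrow> ('a \<Rightarrow> real) \<Rightarrow> bool" where
  "perron V E k x \<longleftrightarrow> (\<forall>u\<in>V. 0 < x u \<and> (\<Sum>v\<in>E `` {u}. x v) = k * x u)"

context connected_graph
begin

abbreviation "radius \<equiv> rho \<lparr>pverts = V, parcs = E\<rparr>"

text \<open>A zero entry of a nonnegative eigenvector forces zeros at all neighbours, hence
  everywhere by connectedness, so the maximising eigenvector is positive. The Rayleigh bound
  identifies its eigenvalue with \<open>rho\<close>.\<close>

lemma perron_exists:
  obtains x where "perron V E radius x"
proof -
  obtain k f where f: "\<And>v. 0 \<le> f v" "\<exists>v\<in>V. f v \<noteq> 0"
    and eig: "\<And>u. u \<in> V \<Longrightarrow> (\<Sum>v\<in>E `` {u}. f v) = k * f u"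
    and ray: "\<And>g. (\<Sum>(u, v)\<in>E. g u * g v) \<le> k * (\<Sum>v\<in>V. (g v :: real)\<^sup>2)"
    using exists_max_eigenvector[OF V_ne] by blast
  have zero_step: "f v = 0" if "f u = 0" "(u, v) \<in> E" for u v
  proof -
    have "u \<in> V" using that(2) E_sub by auto
    then have "(\<Sum>v\<in>E `` {u}. f v) = 0" using eig that(1) by simp
    then show ?thesis using that(2) f(1) by (simp add: sum_nonneg_eq_0_iff finite_nbrs)
  qed
  have "f v \<noteq> 0" if "v \<in> V" for v
  proof
    assume "f v = 0"
    obtain w where w: "w \<in> V" "f w \<noteq> 0" using f(2) by blast
    have "(v, w) \<in> E\<^sup>*" using that w conn by simp
    then have "f w = 0" by induction (use \<open>f v = 0\<close> zero_step in auto)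
    then show False using w by simp
  qed
  then have pos: "0 < f v" if "v \<in> V" for v
    using f(1)[of v] that by (metis less_eq_real_def)
  obtain vs where vs: "distinct vs" "set vs = V"
    using finite_distinct_list[OF finite_V] by blast
  let ?G = "\<lparr>pverts = V, parcs = E\<rparr>"
  have nb: "{v \<in> V. (u, v) \<in> parcs ?G} = E `` {u}" for u
    using E_sub by auto
  have iff: "eigenvalue (adjacency_matrix ?G vs) c \<longleftrightarrow>
     (\<exists>f. (\<exists>v\<in>V. f v \<noteq> 0) \<and> (\<forall>u\<in>V. (\<Sum>v\<in>E `` {u}. f v) = c * f u))" for c
    by (simp only: eigenvalue_adjacency_matrix_iff[OF vs(1)] vs(2) nb)
  have "rho ?G = k"
  proof -
    have "finite {c. eigenvalue (adjacency_matrix ?G vs) c}"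
      by (rule eigenvalues_finite[of _ "length vs"]) (simp add: adjacency_matrix_def)
    moreover have "c \<le> k" if "eigenvalue (adjacency_matrix ?G vs) c" for c
    proof -
      from that obtain g where g: "\<exists>v\<in>V. g v \<noteq> 0" "\<And>u. u \<in> V \<Longrightarrow> (\<Sum>v\<in>E `` {u}. g v) = c * g u"
        unfolding iff by blast
      have "c * (\<Sum>v\<in>V. (g v)\<^sup>2) = (\<Sum>(u, v)\<in>E. g u * g v)"
        using form_eigen_right[of g c g] g(2) by (simp add: power2_eq_square)
      also have "\<dots> \<le> k * (\<Sum>v\<in>V. (g v)\<^sup>2)" by (rule ray)
      finally have "c * (\<Sum>v\<in>V. (g v)\<^sup>2) \<le> k * (\<Sum>v\<in>V. (g v)\<^sup>2)" .
      moreover have "0 < (\<Sum>v\<in>V. (g v)\<^sup>2)"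
        using g(1) finite_V by (auto intro: sum_pos2)
      ultimately show ?thesis by simp
    qed
    moreover have "eigenvalue (adjacency_matrix ?G vs) k"
      unfolding iff using f(2) eig by blast
    ultimately show ?thesis
      using rho_eq[OF vs(1), of ?G] vs(2) by (auto intro!: Max_eqI)
  qed
  then show ?thesis using pos eig that[of f] by (simp add: perron_def)
qed

end

text \<open>The form is mixed: \<open>x\<close> is an eigenvector for \<open>E\<close> and
  \<open>y\<close> for \<open>E'\<close>, so each of the two sums collapses to an eigenvalue times
  the same inner product. That product is positive on a nonempty \<open>V\<close>, hence the sign of
  \<open>k' - k\<close> can be read off from the arcs in which the graphs differ.\<close>

lemma rho_diff_form:
  assumes "sym_graph V E" "sym_graph V E'" "perron V E k x" "perron V E' k' y"
  shows "(k' - k) * (\<Sum>v\<in>V. x v * y v) = (\<Sum>(u, v)\<in>E'. x u * y v) - (\<Sum>(u, v)\<in>E. x u * y v)"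
proof -
  interpret A: sym_graph V E by fact
  interpret B: sym_graph V E' by fact
  show ?thesis
    using A.form_eigen_left[of x k y] B.form_eigen_right[of y k' x] assms(3,4)
    by (simp add: perron_def left_diff_distrib)
qed

text \<open>Every surplus arc contributes a positive term to the mixed form.\<close>

lemma rho_strict_mono:
  assumes "connected_graph V E" "connected_graph V E'" "E \<subset> E'"
  shows "rho \<lparr>pverts = V, parcs = E\<rparr> < rho \<lparr>pverts = V, parcs = E'\<rparr>"
proof -
  interpret A: connected_graph V E by fact
  interpret B: connected_graph V E' by fact
  obtain x where x: "perron V E A.radius x" by (rule A.perron_exists)
  obtain y where y: "perron V E' B.radius y" by (rule B.perron_exists)
  have pos: "0 < x u * y v" if "u \<in> V" "v \<in> V" for u v
    using x y that by (simp add: perron_def)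
  have "(\<Sum>(u, v)\<in>E'. x u * y v) - (\<Sum>(u, v)\<in>E. x u * y v) = (\<Sum>(u, v)\<in>E' - E. x u * y v)"
    using assms(3) B.finite_E by (subst sum_diff) auto
  also have "\<dots> > 0"
    using assms(3) B.finite_E B.E_sub by (intro sum_pos) (auto intro!: pos)
  finally have "0 < (B.radius - A.radius) * (\<Sum>v\<in>V. x v * y v)"
    using rho_diff_form[OF _ _ x y] A.sym_graph_axioms B.sym_graph_axioms by simp
  moreover have "0 < (\<Sum>v\<in>V. x v * y v)"
    using A.finite_V A.V_ne by (intro sum_pos) (auto intro: pos)
  ultimately show ?thesis by (simp add: zero_less_mult_iff)
qed

lemma finite_arg_max:
  fixes f :: "'a \<Rightarrow> 'b :: linorder"
  assumes "finite A" "A \<noteq> {}"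
  obtains a where "a \<in> A" "\<And>b. b \<in> A \<Longrightarrow> f b \<le> f a"
proof -
  have "Max (f ` A) \<in> f ` A" using assms by simp
  then obtain a where "a \<in> A" "f a = Max (f ` A)" by auto
  then show ?thesis using that[of a] assms(1) by simp
qed

section \<open>Bounds on the spectral radius from edge counts and cliques\<close>

context connected_graph
begin

lemma degree_pos:
  assumes "card V \<ge> 2" "v \<in> V"
  shows "card (E `` {v}) \<ge> 1"
proof -
  have "V \<noteq> {v}" using assms(1) by auto
  then obtain w where w: "w \<in> V" "w \<noteq> v" using assms(2) by blast
  then have "(v, w) \<in> E\<^sup>*" using conn assms(2) by blast
  then obtain z where "(v, z) \<in> E" using w(2) by (metis converse_rtranclE)
  then have "E `` {v} \<noteq> {}" by blast
  then show ?thesis using finite_nbrs by (simp add: Suc_le_eq card_gt_0_iff)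
qed

text \<open>Hong's bound; \<open>card E\<close> counts arcs and thus is twice the number of edges.
  Applying the adjacency operator twice at a maximal entry \<open>u\<close> bounds the squared
  radius by the degree sum over the neighbours of \<open>u\<close>. From the total degree sum one
  removes the degree of \<open>u\<close> and at least 1 for each remaining vertex.\<close>

lemma radius_square_le:
  assumes "irrefl E" "card V \<ge> 2"
  shows "radius\<^sup>2 \<le> real (card E) - real (card V) + 1"
proof -
  obtain x where x: "perron V E radius x" by (rule perron_exists)
  obtain u where u: "u \<in> V" and max: "\<And>v. v \<in> V \<Longrightarrow> x v \<le> x u"
    using finite_arg_max[OF finite_V V_ne, of x] by blast
  have eig: "(\<Sum>w\<in>E `` {v}. x w) = radius * x v" if "v \<in> V" for v
    using x that by (simp add: perron_def)
  define N where "N = E `` {u}"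
  define d where "d v = card (E `` {v})" for v
  have N: "N \<subseteq> V" "finite N" "u \<notin> N"
    using nbrs_sub finite_nbrs assms(1) by (auto simp: N_def irrefl_def)
  have "radius\<^sup>2 * x u = radius * (\<Sum>v\<in>N. x v)"
    using eig[OF u] by (simp add: N_def power2_eq_square)
  also have "\<dots> = (\<Sum>v\<in>N. \<Sum>w\<in>E `` {v}. x w)"
    using N eig by (simp add: sum_distrib_left subset_iff)
  also have "\<dots> \<le> (\<Sum>v\<in>N. \<Sum>w\<in>E `` {v}. x u)"
    using nbrs_sub by (intro sum_mono max) auto
  also have "\<dots> = real (\<Sum>v\<in>N. d v) * x u"
    by (simp add: d_def sum_distrib_right)
  finally have "radius\<^sup>2 \<le> real (\<Sum>v\<in>N. d v)"
    using x u by (simp add: perron_def)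
  moreover have "(\<Sum>v\<in>N. d v) + card V \<le> card E + 1"
  proof -
    have "card E = (\<Sum>v\<in>V. d v)"
      by (subst E_Sigma) (simp add: d_def finite_V finite_nbrs)
    also have "\<dots> = (\<Sum>v\<in>N. d v) + d u + (\<Sum>v\<in>V - N - {u}. d v)"
      using N u finite_V by (simp add: sum.subset_diff[of N V] sum.remove[of "V - N" u])
    finally have "card E = (\<Sum>v\<in>N. d v) + d u + (\<Sum>v\<in>V - N - {u}. d v)" .
    moreover have "card (V - N - {u}) \<le> (\<Sum>v\<in>V - N - {u}. d v)"
    proof -
      have "(\<Sum>v\<in>V - N - {u}. 1) \<le> (\<Sum>v\<in>V - N - {u}. d v)"
        using degree_pos[OF assms(2)] by (intro sum_mono) (auto simp: d_def)
      then show ?thesis by simp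
    qed
    moreover have "card (V - N - {u}) = card V - d u - 1"
      using N u by (simp add: card_Diff_subset d_def N_def)
    ultimately show ?thesis by simp
  qed
  ultimately show ?thesis by linarith
qed

text \<open>At the least entry of the Perron vector on the clique, all \<open>card B - 1\<close>
  other clique vertices are neighbours with entries at least as large.\<close>

lemma radius_ge_clique:
  assumes "B \<subseteq> V" "B \<noteq> {}" "\<And>u v. u \<in> B \<Longrightarrow> v \<in> B \<Longrightarrow> u \<noteq> v \<Longrightarrow> (u, v) \<in> E"
  shows "real (card B) - 1 \<le> radius"
proof -
  obtain x where x: "perron V E radius x" by (rule perron_exists)
  have finB: "finite B" using assms(1) finite_V finite_subset by blast
  obtain u where u: "u \<in> B" and "\<And>v. v \<in> B \<Longrightarrow> - x v \<le> - x u"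
    using finite_arg_max[OF finB assms(2), of "\<lambda>v. - x v"] by blast
  then have min: "\<And>v. v \<in> B \<Longrightarrow> x u \<le> x v" by simp
  have "(real (card B) - 1) * x u = (\<Sum>v\<in>B - {u}. x u)"
    using u finB card_gt_0_iff[of B] by (auto simp: of_nat_diff card_Diff_singleton)
  also have "\<dots> \<le> (\<Sum>v\<in>B - {u}. x v)"
    using min by (intro sum_mono) auto
  also have "\<dots> \<le> (\<Sum>v\<in>E `` {u}. x v)"
    using x u assms nbrs_sub[of u] finite_nbrs by (intro sum_mono2) (auto simp: perron_def less_imp_le subset_iff)
  also have "\<dots> = radius * x u"
    using x u assms(1) by (auto simp: perron_def)
  finally show ?thesis
    using x u assms(1) by (auto simp: perron_def)
qed

end

text \<open>With class sizes \<open>N i\<close> between 1 and \<open>m\<close>, the count is the sum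
  of \<open>N i * (N i - 1)\<close>, at most \<open>m\<close> times the sum of
  \<open>N i - 1\<close>, and the latter sum is \<open>card V - l = m\<close>.\<close>

lemma card_same_class_pairs_le:
  fixes c :: "'a \<Rightarrow> nat"
  assumes "finite V" "c ` V = {..<l}" "\<And>i. card {v \<in> V. c v = i} \<le> m" "m + l = card V"
  shows "card {(u, v) \<in> V \<times> V. u \<noteq> v \<and> c u = c v} \<le> m\<^sup>2"
proof -
  define N where "N i = card {v \<in> V. c v = i}" for i
  \<comment> \<open>Nonempty classes keep the subtraction \<open>N i - 1\<close> exact on the
    naturals.\<close>
  have pos: "N i \<ge> 1" if "i < l" for i
  proof -
    have "i \<in> c ` V" using that assms(2) by simp
    then have "{v \<in> V. c v = i} \<noteq> {}" by blast
    then show ?thesis using assms(1) by (simp add: N_def Suc_le_eq card_gt_0_iff)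
  qed
  have img: "c ` V \<subseteq> {..<l}" using assms(2) by simp
  have "{(u, v) \<in> V \<times> V. u \<noteq> v \<and> c u = c v} = Sigma V (\<lambda>u. {v \<in> V. c v = c u} - {u})"
    by auto
  then have "card {(u, v) \<in> V \<times> V. u \<noteq> v \<and> c u = c v} = (\<Sum>u\<in>V. N (c u) - 1)"
    using assms(1) by (simp add: N_def)
  also have "\<dots> = (\<Sum>i<l. \<Sum>u\<in>{v \<in> V. c v = i}. N (c u) - 1)"
    by (rule sum.group[OF assms(1) _ img, symmetric]) simp
  also have "\<dots> = (\<Sum>i<l. N i * (N i - 1))"
    by (intro sum.cong) (auto simp: N_def)
  also have "\<dots> \<le> (\<Sum>i<l. m * (N i - 1))"
    using assms(3) by (intro sum_mono mult_right_mono) (auto simp: N_def)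
  also have "\<dots> = m * ((\<Sum>i<l. N i) - l)"
    using sum_subtractf_nat[of "{..<l}" "\<lambda>_. 1" N] pos by (simp flip: sum_distrib_left)
  also have "(\<Sum>i<l. N i) = card V"
    using sum.group[OF assms(1) _ img, of "\<lambda>_. 1::nat"] by (simp add: N_def)
  also have "m * (card V - l) = m\<^sup>2"
    using assms(4) by (metis add_diff_cancel_right' power2_eq_square)
  finally show ?thesis .
qed

text \<open>At most \<open>m\<^sup>2\<close> arcs lie within classes and at most
  \<open>2 * a\<close> between them. Hong's bound subtracts \<open>card V - 1\<close>, which exceeds
  \<open>2 * a\<close> by the assumption on the order.\<close>

lemma (in connected_graph) radius_less_of_small_classes:
  fixes c :: "'a \<Rightarrow> nat"
  assumes "irrefl E" "c ` V = {..<l}" "\<And>i. card {v \<in> V. c v = i} \<le> m" "m + l = card V"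
    and cross: "card {(u, v) \<in> E. c u \<noteq> c v} \<le> 2 * a"
    and "2 * a + 2 \<le> card V"
  shows "radius < real m"
proof -
  have "E \<subseteq> {(u, v) \<in> V \<times> V. u \<noteq> v \<and> c u = c v} \<union> {(u, v) \<in> E. c u \<noteq> c v}"
    using E_sub assms(1) by (auto simp: irrefl_def)
  then have "card E \<le> card ({(u, v) \<in> V \<times> V. u \<noteq> v \<and> c u = c v} \<union> {(u, v) \<in> E. c u \<noteq> c v})"
    using finite_E finite_V
    by (intro card_mono) (auto intro: finite_subset[of _ "V \<times> V"] finite_subset[of _ E])
  also have "\<dots> \<le> m\<^sup>2 + 2 * a"
    using card_Un_le card_same_class_pairs_le[OF finite_V assms(2-4)] cross
    by (meson add_mono le_trans)
  finally have "real (card E) \<le> (real m)\<^sup>2 + 2 * real a"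
    by (metis of_nat_add of_nat_le_iff of_nat_mult of_nat_numeral of_nat_power)
  moreover have "radius\<^sup>2 \<le> real (card E) - real (card V) + 1"
    using radius_square_le assms(1,6) by simp
  ultimately have "radius\<^sup>2 < (real m)\<^sup>2"
    using assms(6) by linarith
  then show ?thesis by (rule power2_less_imp_less) simp
qed

section \<open>Isomorphism and the shape of the extremal graph\<close>

text \<open>A library isomorphism carries separate maps for vertices, arcs, tails and heads. Under
  \<open>with_proj\<close> the ends of an arc are its components, so the vertex map determines the
  arc map.\<close>

lemma digraph_iso_with_proj_iff:
  assumes "pair_wf_digraph G"
  shows "digraph_iso (with_proj G) (with_proj H) \<longleftrightarrow>
    (\<exists>f. inj_on f (pverts G) \<and> pverts H = f ` pverts G \<and> parcs H = map_prod f f ` parcs G)"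
proof -
  interpret pair_wf_digraph G by fact
  have wf: "wf_digraph (with_proj G)" by unfold_locales
  show ?thesis
  proof
    assume "digraph_iso (with_proj G) (with_proj H)"
    then obtain h where h: "pre_digraph.digraph_isomorphism (with_proj G) h"
      and H: "with_proj H = app_iso h (with_proj G)"
      by (auto simp: digraph_iso_def)
    have ends: "fst = iso_tail h" "snd = iso_head h"
      using arg_cong[OF H, of tail] arg_cong[OF H, of head] by simp_all
    have arc: "iso_arcs h e = map_prod (iso_verts h) (iso_verts h) e" if "e \<in> parcs G" for e
      using h that unfolding pre_digraph.digraph_isomorphism_def ends[symmetric]
      by (auto simp: prod_eq_iff)
    have "pverts H = iso_verts h ` pverts G"
      using arg_cong[OF H, of verts] by simp
    moreover have "parcs H = map_prod (iso_verts h) (iso_verts h) ` parcs G"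
      using arg_cong[OF H, of arcs] arc by simp
    moreover have "inj_on (iso_verts h) (pverts G)"
      using h by (simp add: pre_digraph.digraph_isomorphism_def)
    ultimately show "\<exists>f. inj_on f (pverts G) \<and> pverts H = f ` pverts G \<and> parcs H = map_prod f f ` parcs G"
      by blast
  next
    assume "\<exists>f. inj_on f (pverts G) \<and> pverts H = f ` pverts G \<and> parcs H = map_prod f f ` parcs G"
    then obtain f where f: "inj_on f (pverts G)" "pverts H = f ` pverts G"
      "parcs H = map_prod f f ` parcs G" by blast
    define h where "h = \<lparr>iso_verts = f, iso_arcs = map_prod f f, iso_head = snd, iso_tail = fst\<rparr>"
    have "inj_on (map_prod f f) (parcs G)"
      using f(1) in_arcsD1 in_arcsD2 by (auto simp: inj_on_def) 
    then have "pre_digraph.digraph_isomorphism (with_proj G) h"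
      using f wf by (simp add: pre_digraph.digraph_isomorphism_def h_def)
    moreover have "with_proj H = app_iso h (with_proj G)"
      using f by (simp add: app_iso_def h_def with_proj_def)
    ultimately show "digraph_iso (with_proj G) (with_proj H)"
      by (auto simp: digraph_iso_def)
  qed
qed

text \<open>Listing the vertices of \<open>H\<close> as the images of those of \<open>G\<close>
  gives literally the same matrix.\<close>

lemma rho_iso_eq:
  assumes "finite (pverts G)" "pair_wf_digraph G" "digraph_iso (with_proj G) (with_proj H)"
  shows "rho H = rho G"
proof -
  interpret pair_wf_digraph G by fact
  obtain f where f: "inj_on f (pverts G)" "pverts H = f ` pverts G" "parcs H = map_prod f f ` parcs G"
    using assms by (auto simp: digraph_iso_with_proj_iff)
  obtain vs where vs: "distinct vs" "set vs = pverts G"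
    using finite_distinct_list[OF assms(1)] by blast
  have arc: "(f u, f v) \<in> parcs H \<longleftrightarrow> (u, v) \<in> parcs G" if "u \<in> pverts G" "v \<in> pverts G" for u v
  proof
    assume "(f u, f v) \<in> parcs H"
    then obtain u' v' where "(u', v') \<in> parcs G" "f u = f u'" "f v = f v'"
      unfolding f(3) by auto
    then show "(u, v) \<in> parcs G"
      using f(1) that in_arcsD1 in_arcsD2 by (metis inj_onD)
  qed (auto simp: f(3))
  have "vs ! i \<in> pverts G" if "i < length vs" for i
    using that vs(2) nth_mem by blast
  then have "adjacency_matrix H (map f vs) = adjacency_matrix G vs"
    by (intro eq_matI) (auto simp: adjacency_matrix_def arc)
  moreover have "distinct (map f vs)" "set (map f vs) = pverts H"
    using vs f by (auto simp: distinct_map)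
  ultimately show ?thesis
    using rho_eq[OF vs] rho_eq[of "map f vs" H] by simp
qed

text \<open>Bijections between the colour classes are glued together; class sizes alone will thereby
  yield an isomorphism.\<close>

lemma colour_preserving_bij:
  assumes "finite A" "finite B" "\<And>c. card {a \<in> A. k a = c} = card {b \<in> B. k' b = c}"
  obtains f where "bij_betw f A B" "\<And>a. a \<in> A \<Longrightarrow> k' (f a) = k a"
proof -
  have "\<exists>g. bij_betw g {a \<in> A. k a = c} {b \<in> B. k' b = c}" for c
    using assms by (intro finite_same_card_bij) auto
  then obtain g where g: "\<And>c. bij_betw (g c) {a \<in> A. k a = c} {b \<in> B. k' b = c}" by metis
  define f where "f a = g (k a) a" for a
  have f: "f a \<in> B" "k' (f a) = k a" if "a \<in> A" for a
    using bij_betwE[OF g[of "k a"]] that by (auto simp: f_def)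
  have "inj_on f A"
  proof (rule inj_onI)
    fix a b assume *: "a \<in> A" "b \<in> A" "f a = f b"
    then have "k a = k b" using f(2) by metis
    then show "a = b" using * bij_betw_imp_inj_on[OF g[of "k b"]] by (auto simp: f_def inj_on_def)
  qed
  moreover have "B \<subseteq> f ` A"
  proof
    fix b assume "b \<in> B"
    then have "b \<in> g (k' b) ` {a \<in> A. k a = k' b}"
      using bij_betw_imp_surj_on[OF g[of "k' b"]] by auto
    then obtain a where "a \<in> A" "k a = k' b" "b = g (k' b) a" by auto
    then show "b \<in> f ` A" unfolding f_def by (intro image_eqI[of _ _ a]) simp_all
  qed
  ultimately have "bij_betw f A B" using f(1) by (auto simp: bij_betw_def)
  then show ?thesis using f(2) that by blast
qed

text \<open>The extremal graph on arbitrary vertices. The clique \<open>B\<close> merges the core of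
  the join with the large complete block; the core is \<open>insert w U\<close>, the single vertex
  of the union is \<open>s\<close>, and the pendent vertices \<open>P\<close> hang at
  \<open>w\<close>.\<close>

definition H_arcs :: "'a set \<Rightarrow> 'a \<Rightarrow> 'a set \<Rightarrow> 'a \<Rightarrow> 'a set \<Rightarrow> ('a \<times> 'a) set" where
  "H_arcs B w U s P = {(u, v). u \<in> B \<and> v \<in> B \<and> u \<noteq> v} \<union>
    {s} \<times> insert w U \<union> insert w U \<times> {s} \<union> P \<times> {w} \<union> {w} \<times> P"

text \<open>The colours 0 to 4 mark \<open>w\<close>, \<open>U\<close>, \<open>s\<close>,
  \<open>P\<close> and the rest of \<open>B\<close>. Vertices of one colour are interchangeable:
  colours decide adjacency of distinct vertices through \<open>H_adj\<close>.\<close>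

definition H_colour :: "'a \<Rightarrow> 'a set \<Rightarrow> 'a \<Rightarrow> 'a set \<Rightarrow> 'a \<Rightarrow> nat" where
  "H_colour w U s P v =
    (if v = w then 0 else if v \<in> U then 1 else if v = s then 2 else if v \<in> P then 3 else 4)"

definition H_adj :: "nat \<Rightarrow> nat \<Rightarrow> bool" where
  "H_adj i j \<longleftrightarrow> i \<in> {0, 1, 4} \<and> j \<in> {0, 1, 4} \<or> {i, j} = {0, 2} \<or> {i, j} = {1, 2} \<or> {i, j} = {0, 3}"

locale H_shape =
  fixes B :: "'a set" and w :: 'a and U :: "'a set" and s :: 'a and P :: "'a set"
  assumes finite_B: "finite B" and finite_P: "finite P"
    and w: "w \<in> B" and U: "U \<subseteq> B - {w}" and s: "s \<notin> B" "s \<notin> P" and P: "P \<inter> B = {}"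
begin

definition "VH = B \<union> insert s P"

lemma H_arcs_colour:
  "H_arcs B w U s P = {(u, v) \<in> VH \<times> VH. u \<noteq> v \<and> H_adj (H_colour w U s P u) (H_colour w U s P v)}"
proof -
  let ?k = "H_colour w U s P"
  have k: "?k v = 0 \<longleftrightarrow> v = w" "?k v = 1 \<longleftrightarrow> v \<in> U" "?k v = 2 \<longleftrightarrow> v = s"
    "?k v = 3 \<longleftrightarrow> v \<in> P" "?k v = 4 \<longleftrightarrow> v \<in> B \<and> v \<noteq> w \<and> v \<notin> U" if "v \<in> VH" for v
    using that w U s P by (auto simp: H_colour_def VH_def)
  have H_adj_iff: "H_adj i j \<longleftrightarrow> (i = 0 \<or> i = 1 \<or> i = 4) \<and> (j = 0 \<or> j = 1 \<or> j = 4)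
      \<or> i = 0 \<and> j = 2 \<or> i = 2 \<and> j = 0 \<or> i = 1 \<and> j = 2 \<or> i = 2 \<and> j = 1
      \<or> i = 0 \<and> j = 3 \<or> i = 3 \<and> j = 0" for i j
    unfolding H_adj_def by (simp only: doubleton_eq_iff insert_iff empty_iff) blast
  have adj: "H_adj (?k u) (?k v) \<longleftrightarrow> u \<in> B \<and> v \<in> B \<or> u = w \<and> v = s \<or> u = s \<and> v = w
      \<or> u = s \<and> v \<in> U \<or> u \<in> U \<and> v = s \<or> u = w \<and> v \<in> P \<or> u \<in> P \<and> v = w"
    if "u \<in> VH" "v \<in> VH" for u v
    unfolding H_adj_iff k[OF that(1)] k[OF that(2)] using w U by blast
  have "(u, v) \<in> H_arcs B w U s P \<longleftrightarrow>
      u \<in> VH \<and> v \<in> VH \<and> u \<noteq> v \<and> H_adj (?k u) (?k v)" for u v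
  proof (cases "u \<in> VH \<and> v \<in> VH")
    case True
    then show ?thesis using w U s P unfolding H_arcs_def by (simp only: adj) blast
  next
    case False
    then show ?thesis using w U unfolding H_arcs_def VH_def by blast
  qed
  then show ?thesis by auto
qed

lemma card_H_colour:
  "card {v \<in> VH. H_colour w U s P v = c} =
    (if c = 0 \<or> c = 2 then 1 else if c = 1 then card U else if c = 3 then card P
     else if c = 4 then card B - 1 - card U else 0)"
proof -
  let ?k = "H_colour w U s P"
  have "{v \<in> VH. ?k v = 0} = {w}" "{v \<in> VH. ?k v = 1} = U" "{v \<in> VH. ?k v = 2} = {s}"
    "{v \<in> VH. ?k v = 3} = P" "{v \<in> VH. ?k v = 4} = B - {w} - U"
    using w U s P by (auto simp: H_colour_def VH_def)
  moreover have "card {v \<in> VH. ?k v = c} = 0" if "c \<notin> {0, 1, 2, 3, 4}"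
  proof -
    have "{v \<in> VH. ?k v = c} = {}" using that by (auto simp: H_colour_def)
    then show ?thesis by (simp only: card.empty)
  qed
  moreover have "card (B - {w} - U) = card B - 1 - card U"
    using w U finite_B by (simp add: card_Diff_subset finite_subset)
  ultimately show ?thesis by auto
qed

end

text \<open>The three cardinalities fix the sizes of all five colour classes, and a bijection
  preserving colours preserves adjacency.\<close>

lemma H_shape_iso:
  assumes "H_shape B w U s P" "H_shape B' w' U' s' P'"
    and "card B = card B'" "card U = card U'" "card P = card P'"
  shows "digraph_iso (with_proj \<lparr>pverts = B \<union> insert s P, parcs = H_arcs B w U s P\<rparr>)
    (with_proj \<lparr>pverts = B' \<union> insert s' P', parcs = H_arcs B' w' U' s' P'\<rparr>)"
proof -
  interpret X: H_shape B w U s P by fact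
  interpret Y: H_shape B' w' U' s' P' by fact
  have fin: "finite X.VH" "finite Y.VH"
    by (simp_all add: X.VH_def Y.VH_def X.finite_B X.finite_P Y.finite_B Y.finite_P)
  obtain f where f: "bij_betw f X.VH Y.VH"
    "\<And>v. v \<in> X.VH \<Longrightarrow> H_colour w' U' s' P' (f v) = H_colour w U s P v"
    using colour_preserving_bij[OF fin, of "H_colour w U s P" "H_colour w' U' s' P'"]
    unfolding X.card_H_colour Y.card_H_colour assms(3-5) by blast
  have inj: "inj_on f X.VH" and surj: "f ` X.VH = Y.VH" using f(1) by (auto simp: bij_betw_def)
  have "H_arcs B' w' U' s' P' = map_prod f f ` H_arcs B w U s P"
  proof (intro equalityI subsetI)
    fix e assume "e \<in> H_arcs B' w' U' s' P'"
    then obtain u v where e: "e = (u, v)" "u \<in> Y.VH" "v \<in> Y.VH" "u \<noteq> v"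
      "H_adj (H_colour w' U' s' P' u) (H_colour w' U' s' P' v)"
      unfolding Y.H_arcs_colour by auto
    then obtain u0 v0 where "u = f u0" "v = f v0" "u0 \<in> X.VH" "v0 \<in> X.VH"
      using surj by (metis imageE)
    then show "e \<in> map_prod f f ` H_arcs B w U s P"
      using e f(2) unfolding X.H_arcs_colour by (intro image_eqI[of _ _ "(u0, v0)"]) auto
  next
    fix e assume "e \<in> map_prod f f ` H_arcs B w U s P"
    then obtain u v where e: "e = (f u, f v)" "u \<in> X.VH" "v \<in> X.VH" "u \<noteq> v"
      "H_adj (H_colour w U s P u) (H_colour w U s P v)"
      unfolding X.H_arcs_colour by auto
    then have "f u \<noteq> f v" using inj by (auto dest: inj_onD)
    then show "e \<in> H_arcs B' w' U' s' P'"
      using e f(2) surj unfolding Y.H_arcs_colour by auto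
  qed
  moreover have "pair_wf_digraph \<lparr>pverts = B \<union> insert s P, parcs = H_arcs B w U s P\<rparr>"
    unfolding X.VH_def[symmetric] X.H_arcs_colour by unfold_locales auto
  ultimately show ?thesis
    using inj surj unfolding X.VH_def Y.VH_def
    by (subst digraph_iso_with_proj_iff) (auto simp del: insert_iff image_insert inj_on_insert intro!: exI[of _ f])
qed

text \<open>Here \<open>w\<close> is 0 and \<open>s\<close> is the vertex between the two intervals
  of \<open>B\<close>: the first interval is the core of the join, the second the large complete
  block.\<close>

lemma H_graph_shape:
  assumes "2 \<le> b" "b \<le> a + 1" "a < n"
  defines "B \<equiv> {0..<a + 2 - b} \<union> {a + 3 - b..<n + 2 - b}"
    and "U \<equiv> {1..<a + 2 - b}" and "P \<equiv> {n + 2 - b..<n}"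
  shows "H_shape B 0 U (a + 2 - b) P"
    and "H_graph a b n = \<lparr>pverts = B \<union> insert (a + 2 - b) P, parcs = H_arcs B 0 U (a + 2 - b) P\<rparr>"
    and "card B = n + 1 - b" "card U = a + 1 - b" "card P = b - 2"
proof -
  define q where "q = a + 2 - b"
  define r where "r = n + 2 - b"
  have q: "q \<ge> 1" "q < r" "r \<le> n" "a + 3 - b = Suc q" using assms(1-3) by (auto simp: q_def r_def)
  have BUP: "B = {0..<q} \<union> {Suc q..<r}" "U = {1..<q}" "P = {r..<n}"
    by (simp_all only: B_def U_def P_def q_def[symmetric] r_def[symmetric] q(4))
  show "H_shape B 0 U (a + 2 - b) P"
    unfolding BUP q_def[symmetric] using q by unfold_locales auto
  \<comment> \<open>Two disjoint cliques with all arcs between them form one clique on their union,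
    and the single vertex \<open>q\<close> contributes no arc of its own.\<close>
  have arcs: "{(u, v). u \<in> X \<and> v \<in> X \<and> u \<noteq> v}
      \<union> ({(u, v). u \<in> {q} \<and> v \<in> {q} \<and> u \<noteq> v} \<union> {(u, v). u \<in> Y \<and> v \<in> Y \<and> u \<noteq> v})
      \<union> X \<times> ({q} \<union> Y) \<union> ({q} \<union> Y) \<times> X \<union> {0} \<times> Z \<union> Z \<times> {0}
    = {(u, v). u \<in> X \<union> Y \<and> v \<in> X \<union> Y \<and> u \<noteq> v} \<union> {q} \<times> X \<union> X \<times> {q} \<union> Z \<times> {0} \<union> {0} \<times> Z"
    if "X \<inter> Y = {}" for X Y Z :: "nat set"
    using that by blast
  have "{0..<q} \<inter> {Suc q..<r} = {}" "insert 0 U = {0..<q}" using q by (auto simp: BUP)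
  then have "H_arcs B 0 U q P = parcs (H_graph a b n)"
    unfolding H_arcs_def H_graph_def attach_pendants_def graph_join_def graph_union_def complete_on_def
      q_def[symmetric] r_def[symmetric] q(4) BUP(1,3)
    by (simp only: pair_pre_digraph.select_convs arcs)
  moreover have "B \<union> insert q P = pverts (H_graph a b n)"
    unfolding H_graph_def attach_pendants_def graph_join_def graph_union_def complete_on_def
      q_def[symmetric] r_def[symmetric] q(4) BUP
    using q(1-3) by auto
  ultimately show "H_graph a b n = \<lparr>pverts = B \<union> insert (a + 2 - b) P, parcs = H_arcs B 0 U (a + 2 - b) P\<rparr>"
    by (simp add: q_def)
  have "card B = q + (r - Suc q)"
    unfolding BUP by (subst card_Un_disjoint) auto
  then show "card B = n + 1 - b" using assms(1-3) by (simp add: q_def r_def)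
  show "card U = a + 1 - b" "card P = b - 2" using assms(1-3) by (simp_all add: U_def P_def)
qed

section \<open>Components\<close>

text \<open>Library connectedness is strong connectedness of the symmetric closure, and a symmetric
  arc set is its own closure.\<close>

lemma connected_graph_of_pair_graph:
  assumes "pair_graph G" "Digraph_Component.connected (with_proj G)"
  shows "connected_graph (pverts G) (parcs G)" "irrefl (parcs G)"
proof -
  interpret pair_graph G by fact
  have eq: "parcs (mk_symmetric (with_proj G)) = parcs G"
    using arcs_symmetric by (auto simp: parcs_mk_symmetric)
  have sc: "strongly_connected (with_proj (mk_symmetric (with_proj G)))"
    using assms(2) by (simp add: Digraph_Component.connected_def)
  show "connected_graph (pverts G) (parcs G)"
  proof
    show "finite (pverts G)" by (rule pair_finite_verts)
    show "parcs G \<subseteq> pverts G \<times> pverts G" using in_arcsD1 in_arcsD2 by auto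
    show "sym (parcs G)" using arcs_symmetric by (auto intro: symI)
    show "pverts G \<noteq> {}" using sc by (simp add: strongly_connected_def)
    fix u v assume "u \<in> pverts G" "v \<in> pverts G"
    then have "(u, v) \<in> rtrancl_on (pverts G) (parcs G)"
      using sc by (simp add: strongly_connected_def reachable_def eq)
    then show "(u, v) \<in> (parcs G)\<^sup>*" by (rule rtrancl_on_rtranclI)
  qed
  show "irrefl (parcs G)" using no_loops' by (auto simp: irrefl_def)
qed

text \<open>The classes come from the components left by an optimal set \<open>F\<close> of deleted
  edges. Arcs between classes belong to edges of \<open>F\<close>, and each edge gives at most two
  arcs.\<close>

lemma edge_connectivity_partition:
  assumes "pair_graph G" "1 \<le> l" "l \<le> card (pverts G)"
  obtains c :: "'a \<Rightarrow> nat" where "c ` pverts G = {..<l}"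
    "card {(u, v) \<in> parcs G. c u \<noteq> c v} \<le> 2 * edge_connectivity l G"
proof -
  interpret G: pair_graph G by fact
  have D: "pair_pseudo_graph (delete_edges G F)" for F
    by unfold_locales
      (use G.in_arcsD1 G.in_arcsD2 G.pair_finite_verts G.pair_finite_arcs G.arcs_symmetric in
        \<open>auto simp: delete_edges_def symmetric_def insert_commute intro!: symI
           intro: finite_subset[of _ "parcs G"]\<close>)
  have num: "num_components (delete_edges G F)
      = card (pre_digraph.scc_of (with_proj (delete_edges G F)) ` pverts G)" for F
  proof -
    interpret D: pair_pseudo_graph "delete_edges G F" by (rule D)
    show ?thesis
      using D.card_sccs_verts D.sccs_verts_conv_scc_of
      by (simp add: num_components_def delete_edges_def)
  qed
  \<comment> \<open>Deleting all edges isolates every vertex, so the \<open>LEAST\<close> in the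
    definition has a witness.\<close>
  have "l \<le> num_components (delete_edges G (uedges G))"
  proof -
    interpret D: pair_pseudo_graph "delete_edges G (uedges G)" by (rule D)
    have "parcs (delete_edges G (uedges G)) = {}"
      by (auto simp: delete_edges_def uedges_def)
    then have eq: "u = v" if "reachable (with_proj (delete_edges G (uedges G))) u v" for u v
      using that rtrancl_on_rtranclI[of u v _ "{}"] by (simp add: reachable_def)
    have "pverts (delete_edges G (uedges G)) = pverts G" by (simp add: delete_edges_def)
    then have "D.scc_of u = {u}" if "u \<in> pverts G" for u
      using D.in_scc_of_self[of u] that unfolding D.scc_of_def by (auto dest: eq)
    then have "inj_on D.scc_of (pverts G)" by (auto simp: inj_on_def)
    then show ?thesis using assms(3) by (simp add: num card_image)
  qed
  then have "\<exists>F \<subseteq> uedges G. card F = edge_connectivity l G \<and> l \<le> num_components (delete_edges G F)"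
    unfolding edge_connectivity_def
    by (intro LeastI_ex[of "\<lambda>k. \<exists>F \<subseteq> uedges G. card F = k \<and> l \<le> num_components (delete_edges G F)"]) blast
  then obtain F where F: "F \<subseteq> uedges G" "card F = edge_connectivity l G"
    "l \<le> num_components (delete_edges G F)" by blast
  interpret D: pair_pseudo_graph "delete_edges G F" by (rule D)
  define C where "C = D.scc_of ` pverts G"
  have C: "finite C" "l \<le> card C" using F(3) G.pair_finite_verts by (simp_all add: C_def num)
  obtain h where h: "bij_betw h C {0..<card C}" using ex_bij_betw_finite_nat[OF C(1)] by blast
  \<comment> \<open>Numbering the components from 0, the cap \<open>l - 1\<close> merges all surplus
    components into the last class, so exactly \<open>l\<close> classes remain.\<close>
  define c where "c v = min (h (D.scc_of v)) (l - 1)" for v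
  have "c ` pverts G = {..<l}"
  proof (intro equalityI subsetI)
    fix i assume "i \<in> c ` pverts G"
    then show "i \<in> {..<l}" using assms(2) by (auto simp: c_def)
  next
    fix i assume i: "i \<in> {..<l}"
    then have "i \<in> h ` C" using C(2) bij_betw_imp_surj_on[OF h] by simp
    then obtain v where "v \<in> pverts G" "h (D.scc_of v) = i" by (auto simp: C_def)
    then show "i \<in> c ` pverts G" using i by (intro image_eqI[of _ _ v]) (auto simp: c_def)
  qed
  moreover have "card {(u, v) \<in> parcs G. c u \<noteq> c v} \<le> 2 * card F"
  proof -
    have arc: "(u, v) \<in> parcs (delete_edges G F) \<longleftrightarrow> (u, v) \<in> parcs G \<and> {u, v} \<notin> F" for u v
      by (simp add: delete_edges_def)
    have "D.scc_of u = D.scc_of v" if "(u, v) \<in> parcs (delete_edges G F)" for u v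
    proof -
      let ?R = "reachable (with_proj (delete_edges G F))"
      have "?R u v" "?R v u"
        using that D.arcs_symmetric[OF that] by (auto intro: D.reachable_adjI)
      then show ?thesis by (auto simp: D.scc_of_def intro: D.reachable_trans)
    qed
    then have "c u = c v" if "(u, v) \<in> parcs G" "{u, v} \<notin> F" for u v
      using that unfolding c_def by (metis (mono_tags, lifting) arc)
    then have sub: "{(u, v) \<in> parcs G. c u \<noteq> c v} \<subseteq> (\<Union>e\<in>F. {(u, v) \<in> parcs G. {u, v} = e})"
      by blast
    have finF: "finite F"
      using F(1) G.pair_finite_arcs by (auto simp: uedges_def intro!: finite_subset[of F "(\<lambda>(u, v). {u, v}) ` parcs G"])
    have two: "card {(u, v) \<in> parcs G. {u, v} = e} \<le> 2" if "e \<in> F" for e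
    proof -
      have "e \<in> uedges G" using that F(1) by blast
      then obtain x y where "e = {x, y}" by (auto simp: uedges_def)
      then have "{(u, v) \<in> parcs G. {u, v} = e} \<subseteq> {(x, y), (y, x)}"
        by (auto simp: doubleton_eq_iff)
      then have "card {(u, v) \<in> parcs G. {u, v} = e} \<le> card {(x, y), (y, x)}"
        by (intro card_mono) auto
      also have "\<dots> \<le> 2" by (rule card_insert_le_m1) simp_all
      finally show ?thesis .
    qed
    have "finite (\<Union>e\<in>F. {(u, v) \<in> parcs G. {u, v} = e})"
      by (rule finite_subset[OF _ G.pair_finite_arcs]) blast
    then have "card {(u, v) \<in> parcs G. c u \<noteq> c v} \<le> card (\<Union>e\<in>F. {(u, v) \<in> parcs G. {u, v} = e})"
      using sub by (rule card_mono)
    also have "\<dots> \<le> (\<Sum>e\<in>F. card {(u, v) \<in> parcs G. {u, v} = e})"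
      using finF by (rule card_UN_le)
    also have "\<dots> \<le> (\<Sum>e\<in>F. 2)"
      by (rule sum_mono) (rule two)
    finally show ?thesis by simp
  qed
  ultimately show ?thesis using that[of c] F(2) by simp
qed

section \<open>A clique with few further edges\<close>

text \<open>With \<open>r\<close> the distance to \<open>w\<close>, the parent of \<open>v\<close>
  is a neighbour at smaller distance. Distances decrease along parents, so no edge is the parent
  edge of both its ends.\<close>

lemma (in connected_graph) parent_function:
  assumes "w \<in> V"
  obtains p where "\<And>v. v \<in> V - {w} \<Longrightarrow> (v, p v) \<in> E"
    "\<And>v. v \<in> V - {w} \<Longrightarrow> (v, w) \<in> E \<Longrightarrow> p v = w"
    "\<And>v. v \<in> V - {w} \<Longrightarrow> p v \<noteq> w \<Longrightarrow> p (p v) \<noteq> v"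
proof -
  define r where "r v = (LEAST n. (v, w) \<in> E ^^ n)" for v
  have r: "(v, w) \<in> E ^^ r v" if "v \<in> V" for v
    unfolding r_def using conn[OF that assms] by (metis LeastI rtrancl_imp_relpow)
  have r_le: "r v \<le> n" if "(v, w) \<in> E ^^ n" for v n
    unfolding r_def using that by (rule Least_le)
  have r0: "v = w" if "r v = 0" "v \<in> V" for v
    using r[OF that(2)] that(1) by simp
  have "\<exists>u. (v, u) \<in> E \<and> r u < r v" if "v \<in> V - {w}" for v
  proof -
    have "r v \<noteq> 0" using r0[of v] that by auto
    then obtain n where n: "r v = Suc n" by (meson not0_implies_Suc)
    then have "(v, w) \<in> E ^^ Suc n" using r[of v] that by simp
    then obtain u where "(v, u) \<in> E" "(u, w) \<in> E ^^ n" by (rule relpow_E2) simp_all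
    then show ?thesis using r_le[of u n] n by auto
  qed
  then obtain p where p: "\<And>v. v \<in> V - {w} \<Longrightarrow> (v, p v) \<in> E \<and> r (p v) < r v" by metis
  have pV: "p v \<in> V" if "v \<in> V - {w}" for v using p[OF that] E_sub by auto
  show ?thesis
  proof
    fix v assume v: "v \<in> V - {w}"
    show "(v, p v) \<in> E" using p[OF v] by simp
    show "p v = w" if "(v, w) \<in> E"
    proof -
      have "r v \<le> 1" using r_le[of v 1] that by simp
      then have "r (p v) = 0" using p[OF v] by simp
      then show ?thesis using r0 pV[OF v] by simp
    qed
    show "p (p v) \<noteq> v" if "p v \<noteq> w"
      using p[OF v] p[of "p v"] pV[OF v] that by auto
  qed
qed

text \<open>Both arcs of each edge from \<open>z\<close> to \<open>p z\<close>. A constant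
  \<open>p\<close> gives a star, so parent edges and the stars at \<open>w\<close> and
  \<open>s\<close> share one treatment.\<close>

definition arcs_of :: "'a set \<Rightarrow> ('a \<Rightarrow> 'a) \<Rightarrow> ('a \<times> 'a) set" where
  "arcs_of A p = (\<lambda>z. (z, p z)) ` A \<union> (\<lambda>z. (p z, z)) ` A"

lemma arcs_of_iff: "(u, v) \<in> arcs_of A p \<longleftrightarrow> u \<in> A \<and> v = p u \<or> v \<in> A \<and> u = p v"
  by (auto simp: arcs_of_def)

text \<open>The assumption on \<open>p\<close> keeps the two arc families disjoint: no edge is
  listed from both ends, and no loop occurs.\<close>

lemma
  assumes "finite A" "\<And>z. z \<in> A \<Longrightarrow> p z \<in> A \<Longrightarrow> p (p z) \<noteq> z"
  shows sum_arcs_of: "(\<Sum>(u, v)\<in>arcs_of A p. f u v) = (\<Sum>z\<in>A. f z (p z) + f (p z) z)"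
    and card_arcs_of: "card (arcs_of A p) = 2 * card A"
proof -
  have disj: "(\<lambda>z. (z, p z)) ` A \<inter> (\<lambda>z. (p z, z)) ` A = {}"
    using assms(2) by auto
  have inj: "inj_on (\<lambda>z. (z, p z)) A" "inj_on (\<lambda>z. (p z, z)) A" by (auto intro: inj_onI)
  show "(\<Sum>(u, v)\<in>arcs_of A p. f u v) = (\<Sum>z\<in>A. f z (p z) + f (p z) z)"
    unfolding arcs_of_def using assms(1) disj inj
    by (simp add: sum.union_disjoint sum.reindex sum.distrib)
  show "card (arcs_of A p) = 2 * card A"
    unfolding arcs_of_def using assms(1) disj inj by (simp add: card_Un_disjoint card_image)
qed

lemma H_arcs_eq_arcs_of:
  "H_arcs B w U s P = {(u, v). u \<in> B \<and> v \<in> B \<and> u \<noteq> v} \<union> arcs_of (insert s P) (\<lambda>_. w) \<union> arcs_of U (\<lambda>_. s)"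
  unfolding H_arcs_def arcs_of_def by blast

section \<open>The Perron vector of the extremal graph\<close>

context H_shape
begin

abbreviation "H \<equiv> H_arcs B w U s P"

lemma finite_U: "finite U"
  using U finite_B by (meson Diff_subset finite_subset)

lemma H_nbrs:
  shows "z \<in> P \<Longrightarrow> H `` {z} = {w}" and "H `` {s} = insert w U"
    and "u \<in> U \<Longrightarrow> H `` {u} = insert s (B - {u})"
    and "b \<in> B - U - {w} \<Longrightarrow> H `` {b} = B - {b}"
    and "H `` {w} = (B - {w}) \<union> insert s P"
proof -
  have "z \<notin> B" "z \<noteq> s" if "z \<in> P" for z using that P s by auto
  then show "z \<in> P \<Longrightarrow> H `` {z} = {w}"
    using U w unfolding H_arcs_def by blast
  show "H `` {s} = insert w U"
    using s w U unfolding H_arcs_def by blast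
  show "u \<in> U \<Longrightarrow> H `` {u} = insert s (B - {u})"
    using s w U P unfolding H_arcs_def by blast
  show "b \<in> B - U - {w} \<Longrightarrow> H `` {b} = B - {b}"
    using s w U P unfolding H_arcs_def by blast
  show "H `` {w} = (B - {w}) \<union> insert s P"
    using s w U P unfolding H_arcs_def by blast
qed

lemma connected_H: "connected_graph VH H"
proof
  show "finite VH" by (simp add: VH_def finite_B finite_P)
  show "H \<subseteq> VH \<times> VH" unfolding H_arcs_colour by auto
  show sym: "sym H" unfolding H_arcs_def by (rule symI) blast
  show "VH \<noteq> {}" by (simp add: VH_def)
  have to_w: "(v, w) \<in> H\<^sup>*" if "v \<in> VH" for v
  proof -
    have "v = w \<or> (v, w) \<in> H" using that w unfolding VH_def H_arcs_def by blast
    then show ?thesis by auto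
  qed
  fix u v assume "u \<in> VH" "v \<in> VH"
  then have "(u, w) \<in> H\<^sup>*" "(w, v) \<in> H\<^sup>*"
    using to_w sym_rtrancl[OF sym] by (auto dest: symD)
  then show "(u, v) \<in> H\<^sup>*" by (rule rtrancl_trans)
qed

abbreviation "rhoH \<equiv> rho \<lparr>pverts = VH, parcs = H\<rparr>"

lemma rhoH_ge: "real (card B) - 1 \<le> rhoH"
proof -
  interpret connected_graph VH H by (rule connected_H)
  show ?thesis
    using w by (intro radius_ge_clique) (auto simp: VH_def H_arcs_def)
qed

context
  fixes y
  assumes y: "perron VH H rhoH y"
begin

lemma y_pos: "v \<in> VH \<Longrightarrow> 0 < y v"
  using y by (simp add: perron_def)

lemma y_eig: "v \<in> VH \<Longrightarrow> (\<Sum>u\<in>H `` {v}. y u) = rhoH * y v"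
  using y by (simp add: perron_def)

lemma y_P: "z \<in> P \<Longrightarrow> rhoH * y z = y w"
  using y_eig[of z] H_nbrs(1)[of z] by (simp add: VH_def)

lemma y_s: "rhoH * y s = y w + sum y U"
proof -
  have "w \<notin> U" using U by auto
  then show ?thesis using y_eig[of s] H_nbrs(2) finite_U by (simp add: VH_def)
qed

lemma y_w: "(rhoH + 1) * y w = sum y B + y s + sum y P"
proof -
  have "sum y ((B - {w}) \<union> insert s P) = sum y (B - {w}) + sum y (insert s P)"
    using finite_B finite_P s P by (intro sum.union_disjoint) auto
  then show ?thesis
    using y_eig[of w] H_nbrs(5) w s finite_B finite_P
    by (simp add: VH_def sum.remove[of B w] algebra_simps)
qed

text \<open>Adding the own entry to an eigenvalue equation gives a sum over the closed
  neighbourhood, with factor \<open>rhoH + 1\<close>. The closed neighbourhoods of \<open>w\<close>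
  and \<open>u\<close> differ exactly in \<open>P\<close>; for the remaining vertices of
  \<open>B\<close>, treated next, \<open>s\<close> is missing too.\<close>

lemma y_U: "u \<in> U \<Longrightarrow> (rhoH + 1) * (y w - y u) = sum y P"
  using y_eig[of u] H_nbrs(3)[of u] y_w U s finite_B
  by (auto simp: VH_def sum.remove[of B u] algebra_simps)

lemma y_B: "b \<in> B - U - {w} \<Longrightarrow> (rhoH + 1) * (y w - y b) = y s + sum y P"
  using y_eig[of b] H_nbrs(4)[of b] y_w finite_B
  by (auto simp: VH_def sum.remove[of B b] algebra_simps)

end

end

section \<open>Estimates for the Perron vector of the given graph\<close>

locale clique_graph = connected_graph V E for V :: "'a set" and E +
  fixes B S :: "'a set" and t :: nat
  assumes irrefl_E: "irrefl E" and V_eq: "V = B \<union> S" and BS: "B \<inter> S = {}" and S_ne: "S \<noteq> {}"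
    and clique: "\<And>u v. u \<in> B \<Longrightarrow> v \<in> B \<Longrightarrow> u \<noteq> v \<Longrightarrow> (u, v) \<in> E"
    and few: "card {(u, v) \<in> E. u \<in> S \<or> v \<in> S} \<le> 2 * (card S + t)"
    and big: "card S + 2 * t + 2 \<le> card B"
begin

lemma finite_BS: "finite B" "finite S"
  using finite_V V_eq by auto

lemma B_ne: "B \<noteq> {}"
  using big by auto

lemma radius_ge: "real (card B) - 1 \<le> radius"
  using V_eq B_ne clique by (intro radius_ge_clique) auto

end

locale clique_parent = clique_graph +
  fixes x :: "'a \<Rightarrow> real" and w s :: 'a and p :: "'a \<Rightarrow> 'a"
  assumes x: "perron V E radius x"
    and w: "w \<in> B" and w_max: "\<And>b. b \<in> B \<Longrightarrow> x b \<le> x w"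
    and s: "s \<in> S" and s_max: "\<And>z. z \<in> S \<Longrightarrow> x z \<le> x s"
    and p_arc: "\<And>z. z \<in> S \<Longrightarrow> (z, p z) \<in> E"
    and p_w: "\<And>z. z \<in> S \<Longrightarrow> (z, w) \<in> E \<Longrightarrow> p z = w"
    and p_p: "\<And>z. z \<in> S \<Longrightarrow> p z \<in> S \<Longrightarrow> p (p z) \<noteq> z"
begin

lemma x_pos: "v \<in> V \<Longrightarrow> 0 < x v"
  using x by (simp add: perron_def)

lemma x_eig: "v \<in> V \<Longrightarrow> (\<Sum>u\<in>E `` {v}. x u) = radius * x v"
  using x by (simp add: perron_def)

lemma x_nbr_nonneg: "(u, v) \<in> E \<Longrightarrow> 0 \<le> x v"
  using x_pos[of v] E_sub by auto

definition "U1 = {b \<in> B. (s, b) \<in> E \<and> b \<noteq> p s}"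

text \<open>If \<open>w\<close> is adjacent to \<open>s\<close>, then it is the parent of
  \<open>s\<close> and hence not in \<open>U1\<close>.\<close>

lemma U1_sub: "U1 \<subseteq> B - {w}"
  using p_w[OF s] by (auto simp: U1_def)

lemma finite_U1: "finite U1"
  using finite_BS by (simp add: U1_def)

definition "extra = {(u, v) \<in> E. u \<in> S \<or> v \<in> S} - arcs_of S p - arcs_of U1 (\<lambda>_. s)"

lemma arcs_of_p_sub: "arcs_of S p \<subseteq> {(u, v) \<in> E. u \<in> S \<or> v \<in> S}"
  using p_arc E_symD by (auto simp: arcs_of_iff)

lemma U1_arcs_sub: "arcs_of U1 (\<lambda>_. s) \<subseteq> {(u, v) \<in> E. u \<in> S \<or> v \<in> S} - arcs_of S p"
  using s E_symD BS by (auto simp: arcs_of_iff U1_def)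

lemma finite_extra: "finite extra"
  unfolding extra_def by (rule finite_subset[OF _ finite_E]) auto

text \<open>Of the at most \<open>card S + t\<close> edges meeting \<open>S\<close>, the parent
  edges use \<open>card S\<close>. The edges from \<open>s\<close> to \<open>U1\<close> and the
  extra ones share the remaining \<open>t\<close>; all counts are of arcs, whence the factors
  2.\<close>

lemma card_extra: "card extra + 2 * card U1 \<le> 2 * t"
proof -
  let ?A = "{(u, v) \<in> E. u \<in> S \<or> v \<in> S}"
  have finA: "finite ?A" by (rule finite_subset[OF _ finite_E]) auto
  have c1: "card (arcs_of S p) = 2 * card S"
    using finite_BS p_p by (intro card_arcs_of) auto
  have c2: "card (arcs_of U1 (\<lambda>_. s)) = 2 * card U1"
    using finite_U1 s BS by (intro card_arcs_of) (auto simp: U1_def)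
  have le: "card (arcs_of S p) \<le> card ?A"
    "card (arcs_of U1 (\<lambda>_. s)) \<le> card (?A - arcs_of S p)"
    using arcs_of_p_sub U1_arcs_sub finA by (auto intro!: card_mono)
  have "card (?A - arcs_of S p) = card ?A - card (arcs_of S p)"
    using arcs_of_p_sub finA by (intro card_Diff_subset) (auto intro: finite_subset)
  then have "card (?A - arcs_of S p) \<le> 2 * t"
    using few le(1) by (simp add: c1)
  moreover have "card extra = card (?A - arcs_of S p) - card (arcs_of U1 (\<lambda>_. s))"
    unfolding extra_def using U1_arcs_sub finA
    by (intro card_Diff_subset) (auto intro: finite_subset)
  ultimately show ?thesis using le(2) c2 by simp
qed

lemma extra_sym: "(u, v) \<in> extra \<Longrightarrow> (v, u) \<in> extra"
  using E_symD by (auto simp: extra_def arcs_of_iff)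

lemma E_decomp:
  "E = {(u, v). u \<in> B \<and> v \<in> B \<and> u \<noteq> v} \<union> arcs_of S p \<union> arcs_of U1 (\<lambda>_. s) \<union> extra"
proof -
  have "E = {(u, v). u \<in> B \<and> v \<in> B \<and> u \<noteq> v} \<union> {(u, v) \<in> E. u \<in> S \<or> v \<in> S}"
    using E_sub V_eq clique irrefl_E by (auto simp: irrefl_def)
  then show ?thesis using arcs_of_p_sub U1_arcs_sub unfolding extra_def by blast
qed

lemma sum_E_decomp:
  fixes f :: "'a \<Rightarrow> 'a \<Rightarrow> real"
  shows "(\<Sum>(u, v)\<in>E. f u v) = (\<Sum>(u, v)\<in>{(u, v). u \<in> B \<and> v \<in> B \<and> u \<noteq> v}. f u v)
    + (\<Sum>z\<in>S. f z (p z) + f (p z) z) + (\<Sum>u\<in>U1. f u s + f s u) + (\<Sum>(u, v)\<in>extra. f u v)"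
proof -
  let ?B = "{(u, v). u \<in> B \<and> v \<in> B \<and> u \<noteq> v}"
  have fin: "finite ?B" "finite (arcs_of S p)" "finite (arcs_of U1 (\<lambda>_. s))"
    using finite_BS finite_U1 finite_subset[of ?B "B \<times> B"] by (auto simp: arcs_of_def)
  have d: "?B \<inter> arcs_of S p = {}" "(?B \<union> arcs_of S p) \<inter> arcs_of U1 (\<lambda>_. s) = {}"
    "(?B \<union> arcs_of S p \<union> arcs_of U1 (\<lambda>_. s)) \<inter> extra = {}"
    using arcs_of_p_sub U1_arcs_sub BS unfolding extra_def by blast+
  have 1: "(\<Sum>(u, v)\<in>arcs_of S p. f u v) = (\<Sum>z\<in>S. f z (p z) + f (p z) z)"
    using finite_BS p_p by (intro sum_arcs_of) auto
  have 2: "(\<Sum>(u, v)\<in>arcs_of U1 (\<lambda>_. s). f u v) = (\<Sum>u\<in>U1. f u s + f s u)"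
    using finite_U1 s BS by (intro sum_arcs_of) (auto simp: U1_def)
  show ?thesis
    using fin d finite_extra by (subst E_decomp) (simp add: sum.union_disjoint 1 2)
qed

text \<open>The eigenvalue equation at \<open>s\<close>: at most \<open>t + 1\<close> neighbours in
  \<open>B\<close> with entries up to \<open>x w\<close>, and at most \<open>card S - 1\<close> in
  \<open>S\<close> with entries up to \<open>x s\<close>. The radius is at least
  \<open>card S + 2 * t + 1\<close>.\<close>

lemma two_x_s_le: "2 * x s \<le> x w"
proof -
  have sV: "s \<in> V" "s \<notin> B" using s V_eq BS by auto
  have part: "E `` {s} = (E `` {s} \<inter> B) \<union> (E `` {s} \<inter> S)"
    using nbrs_sub V_eq by blast
  have "radius * x s = sum x (E `` {s} \<inter> B) + sum x (E `` {s} \<inter> S)"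
    using x_eig[OF sV(1)] part sum.union_disjoint[of "E `` {s} \<inter> B" "E `` {s} \<inter> S" x] finite_nbrs BS
    by auto
  also have "sum x (E `` {s} \<inter> B) \<le> real (card (E `` {s} \<inter> B)) * x w"
    using w_max by (intro sum_bounded_above) auto
  also have "real (card (E `` {s} \<inter> B)) * x w \<le> (real t + 1) * x w"
  proof -
    have "E `` {s} \<inter> B \<subseteq> insert (p s) U1" by (auto simp: U1_def)
    then have "card (E `` {s} \<inter> B) \<le> card (insert (p s) U1)"
      using finite_U1 by (intro card_mono) auto
    also have "\<dots> \<le> Suc (card U1)"
      using finite_U1 by (simp add: card_insert_if)
    finally have "real (card (E `` {s} \<inter> B)) \<le> real t + 1" using card_extra by linarith
    then show ?thesis using x_pos[of w] w V_eq by (intro mult_right_mono) auto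
  qed
  also have "sum x (E `` {s} \<inter> S) \<le> real (card (E `` {s} \<inter> S)) * x s"
    using s_max by (intro sum_bounded_above) auto
  also have "real (card (E `` {s} \<inter> S)) * x s \<le> (real (card S) - 1) * x s"
  proof -
    have "E `` {s} \<inter> S \<subseteq> S - {s}" using irrefl_E by (auto simp: irrefl_def)
    then have "card (E `` {s} \<inter> S) \<le> card (S - {s})" using finite_BS by (intro card_mono) auto
    moreover have "card S = Suc (card (S - {s}))" using s finite_BS by (metis card_Suc_Diff1)
    ultimately have "real (card (E `` {s} \<inter> S)) \<le> real (card S) - 1" by linarith
    then show ?thesis using x_pos[OF sV(1)] by (intro mult_right_mono) auto
  qed
  finally have "radius * x s \<le> (real t + 1) * x w + (real (card S) - 1) * x s"
    by simp
  moreover have "(real (card S) + 2 * real t + 1) * x s \<le> radius * x s"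
    using radius_ge big x_pos[OF sV(1)] by (intro mult_right_mono) auto
  ultimately have "(real t + 1) * (2 * x s) \<le> (real t + 1) * x w"
    by (simp add: algebra_simps)
  then show ?thesis by simp
qed

text \<open>The closed neighbourhood of \<open>w\<close> lies in \<open>B \<union> S\<close>, that
  of \<open>b\<close> contains \<open>B\<close>. So the two eigenvalue equations differ by at most
  the sum of \<open>x\<close> over \<open>S\<close>.\<close>

lemma x_w_minus_le:
  assumes "b \<in> B"
  shows "real (card B) * (x w - x b) \<le> real (card S) * x s"
proof -
  have V: "w \<in> V" "b \<in> V" using w assms V_eq by auto
  have "radius * x w \<le> sum x (B - {w}) + sum x S"
  proof -
    have "E `` {w} \<subseteq> (B - {w}) \<union> S" using E_sub V_eq irrefl_E by (auto simp: irrefl_def)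
    then have "sum x (E `` {w}) \<le> sum x ((B - {w}) \<union> S)"
      using finite_BS x_pos V_eq by (intro sum_mono2) (auto intro: less_imp_le)
    also have "\<dots> = sum x (B - {w}) + sum x S"
      using finite_BS BS by (intro sum.union_disjoint) auto
    finally show ?thesis using x_eig[OF V(1)] by simp
  qed
  moreover have "sum x S \<le> real (card S) * x s"
    using s_max by (intro sum_bounded_above) auto
  moreover have "sum x (B - {b}) \<le> radius * x b"
  proof -
    have "B - {b} \<subseteq> E `` {b}" using clique assms by auto
    then have "sum x (B - {b}) \<le> sum x (E `` {b})"
      using finite_nbrs x_nbr_nonneg by (intro sum_mono2) auto
    then show ?thesis using x_eig[OF V(2)] by simp
  qed
  moreover have "sum x B = x w + sum x (B - {w})" "sum x B = x b + sum x (B - {b})"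
    using sum.remove[OF finite_BS(1) w] sum.remove[OF finite_BS(1) assms] by auto
  ultimately have "(radius + 1) * (x w - x b) \<le> real (card S) * x s"
    by (simp add: algebra_simps)
  moreover have "real (card B) * (x w - x b) \<le> (radius + 1) * (x w - x b)"
    using radius_ge w_max[OF assms] by (intro mult_right_mono) auto
  ultimately show ?thesis by simp
qed

lemma x_max: "v \<in> V \<Longrightarrow> x v \<le> x w"
  using w_max s_max[of v] two_x_s_le x_pos[of s] s V_eq by force

end

section \<open>Comparison with the extremal graph on the same vertices\<close>

locale clique_choice = clique_parent +
  fixes U :: "'a set" and y :: "'a \<Rightarrow> real"
  assumes U: "U1 \<subseteq> U" "U \<subseteq> B - {w}" "card U = t"
    and y: "perron (B \<union> insert s (S - {s})) (H_arcs B w U s (S - {s}))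
      (rho \<lparr>pverts = B \<union> insert s (S - {s}), parcs = H_arcs B w U s (S - {s})\<rparr>) y"
begin

abbreviation "P \<equiv> S - {s}"

sublocale HS: H_shape B w U s P
  using finite_BS w U s BS by unfold_locales auto

lemma VH_eq: "HS.VH = V"
  using s V_eq by (auto simp: HS.VH_def)

lemma y': "perron HS.VH HS.H HS.rhoH y"
  using y by (simp only: HS.VH_def)

definition m where "m = HS.rhoH"

lemma yP: "z \<in> P \<Longrightarrow> m * y z = y w"
  and ys: "m * y s = y w + sum y U"
  and yU: "u \<in> U \<Longrightarrow> (m + 1) * (y w - y u) = sum y P"
  and yB: "b \<in> B - U - {w} \<Longrightarrow> (m + 1) * (y w - y b) = y s + sum y P"
  and ypos: "v \<in> V \<Longrightarrow> 0 < y v"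
  using HS.y_P[OF y'] HS.y_s[OF y'] HS.y_U[OF y'] HS.y_B[OF y'] HS.y_pos[OF y']
  by (simp_all add: m_def VH_eq)

lemma m_ge: "real (card S) + 2 * real t + 1 \<le> m" "real (card B) \<le> m + 1"
  using HS.rhoH_ge big by (simp_all add: m_def)

lemma S_card: "1 \<le> card S"
  using S_ne finite_BS by (simp add: Suc_le_eq card_gt_0_iff)

lemma m_gt: "2 \<le> m" "real t + 1 < m" "real (card S) < m"
  using m_ge S_card by linarith+

lemma V: "w \<in> V" "s \<in> V" "b \<in> B \<Longrightarrow> b \<in> V" "z \<in> S \<Longrightarrow> z \<in> V" "u \<in> U \<Longrightarrow> u \<in> V"
  using w s V_eq U by auto

text \<open>Each pendent entry is \<open>y w / m\<close>, and there are fewer than \<open>m\<close>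
  of them.\<close>

lemma sum_yP: "0 \<le> sum y P" "sum y P \<le> y w"
proof -
  show "0 \<le> sum y P" using ypos V by (intro sum_nonneg less_imp_le) auto
  have "m * sum y P = (\<Sum>z\<in>P. y w)"
    unfolding sum_distrib_left by (intro sum.cong yP) auto
  also have "\<dots> = real (card P) * y w" by simp
  also have "\<dots> \<le> m * y w"
  proof -
    have "card P \<le> card S" using finite_BS by (intro card_mono) auto
    then show ?thesis using m_gt ypos[OF V(1)] by (intro mult_right_mono) auto
  qed
  finally show "sum y P \<le> y w" using m_gt by simp
qed

lemma yU_le: "u \<in> U \<Longrightarrow> y u \<le> y w"
  and yU_ge: "u \<in> U \<Longrightarrow> real (card B) * (y w - y u) \<le> y w"
proof -
  assume u: "u \<in> U"
  have "0 \<le> (m + 1) * (y w - y u)" using yU[OF u] sum_yP by simp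
  then show le: "y u \<le> y w" using m_gt by (simp add: zero_le_mult_iff)
  have "real (card B) * (y w - y u) \<le> (m + 1) * (y w - y u)"
    using m_ge le by (intro mult_right_mono) auto
  then show "real (card B) * (y w - y u) \<le> y w" using yU[OF u] sum_yP by simp
qed

lemma yB_less: "b \<in> B - U - {w} \<Longrightarrow> y b < y w"
  and yB_less_U: "b \<in> B - U - {w} \<Longrightarrow> u \<in> U \<Longrightarrow> y b < y u"
proof -
  assume b: "b \<in> B - U - {w}"
  have "0 < (m + 1) * (y w - y b)" using yB[OF b] sum_yP ypos[OF V(2)] by simp
  then show "y b < y w" using m_gt by (simp add: zero_less_mult_iff)
  assume u: "u \<in> U"
  have "0 < (m + 1) * (y u - y b)"
    using yB[OF b] yU[OF u] ypos[OF V(2)] by (simp add: algebra_simps)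
  then show "y b < y u" using m_gt by (simp add: zero_less_mult_iff)
qed

text \<open>The degree of \<open>s\<close> in the extremal graph is \<open>t + 1\<close>, and that
  of a pendent vertex is 1; both are below \<open>m\<close>.\<close>

lemma yS_less: "z \<in> S \<Longrightarrow> y z < y w"
proof -
  assume z: "z \<in> S"
  have "sum y U \<le> real t * y w" using yU_le U(3) sum_bounded_above[of U y "y w"] by simp
  then have "m * y s \<le> (real t + 1) * y w" using ys by (simp add: algebra_simps)
  also have "\<dots> < m * y w" using m_gt ypos[OF V(1)] by (intro mult_strict_right_mono) auto
  finally have "y s < y w" using m_gt by simp
  moreover have "y z < y w" if "z \<in> P"
  proof -
    have "1 * y z < m * y z" using m_gt ypos[OF V(4)[OF z]] by (intro mult_strict_right_mono) auto
    then show ?thesis using yP[OF that] by simp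
  qed
  ultimately show ?thesis using z by auto
qed

lemma y_max: "v \<in> V \<Longrightarrow> y v \<le> y w"
  using yS_less[of v] yU_le[of v] yB_less[of v] V_eq by fastforce

text \<open>On \<open>B\<close> the entries of \<open>x\<close> fall short of \<open>x w\<close> by
  a fraction of at most \<open>card S / (2 * card B)\<close>, and on \<open>U\<close> those of
  \<open>y\<close> fall short of \<open>y w\<close> by at most \<open>1 / card B\<close>. As
  \<open>card S + 2 \<le> card B\<close>, the total loss is less than one copy of
  \<open>x w * y w\<close>.\<close>

lemma xU_yU: "u \<in> U \<Longrightarrow> x w * y w < x u * (y w + y u)"
  and xU_gt: "b \<in> B \<Longrightarrow> x s < x b"
proof -
  let ?N = "real (card B)"
  have half: "2 * (?N * (x w - x b)) \<le> real (card S) * x w" if "b \<in> B" for b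
  proof -
    have "2 * (?N * (x w - x b)) \<le> 2 * (real (card S) * x s)" using x_w_minus_le[OF that] by simp
    also have "\<dots> = real (card S) * (2 * x s)" by simp
    also have "\<dots> \<le> real (card S) * x w" using two_x_s_le by (intro mult_left_mono) auto
    finally show ?thesis .
  qed
  have N: "real (card S) + 2 \<le> ?N" using big by linarith
  have xw: "0 < x w" "0 < y w" using x_pos ypos V by auto
  {
    assume b: "b \<in> B"
    have "2 * (?N * (x w - x b)) \<le> real (card S) * x w" by (rule half[OF b])
    also have "\<dots> < ?N * x w" using N xw by (intro mult_strict_right_mono) auto
    finally have "?N * (2 * (x w - x b)) < ?N * x w" by (metis mult.left_commute)
    then have "2 * (x w - x b) < x w" using N by (simp only: mult_less_cancel_left_pos)
    then show "x s < x b" using two_x_s_le by simp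
  }
  assume u: "u \<in> U"
  then have uB: "u \<in> B" using U by auto
  have "?N * (2 * x w * y w - x u * (y w + y u))
      = 2 * (?N * (x w - x u)) * y w + x u * (?N * (y w - y u))"
    by (simp add: algebra_simps)
  also have "\<dots> \<le> real (card S) * x w * y w + x w * y w"
  proof (rule add_mono)
    show "2 * (?N * (x w - x u)) * y w \<le> real (card S) * x w * y w"
      using half[OF uB] xw by (intro mult_right_mono) auto
    have "0 < x u" using x_pos V(3)[OF uB] by simp
    then show "x u * (?N * (y w - y u)) \<le> x w * y w"
      using yU_ge[OF u] yU_le[OF u] w_max[OF uB] xw N by (intro mult_mono) auto
  qed
  also have "\<dots> = (real (card S) + 1) * (x w * y w)" by (simp add: algebra_simps)
  also have "\<dots> < ?N * (x w * y w)"
    using N xw by (intro mult_strict_right_mono) auto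
  finally have "2 * x w * y w - x u * (y w + y u) < x w * y w"
    using N by (simp only: mult_less_cancel_left_pos)
  then show "x w * y w < x u * (y w + y u)" by simp
qed

text \<open>The weight of an edge in the mixed form, both of its arcs taken together.\<close>

definition W where "W u v = x u * y v + x v * y u"

lemma W_pos: "u \<in> V \<Longrightarrow> v \<in> V \<Longrightarrow> 0 < W u v"
  using x_pos ypos by (simp add: W_def add_pos_pos)

text \<open>Both \<open>x\<close> and \<open>y\<close> are maximal at \<open>w\<close>, so
  redirecting an edge to \<open>w\<close> never lowers its weight.\<close>

lemma W_le_w:
  assumes "z \<in> V" "v \<in> V"
  shows "W z v \<le> W z w" and "W z v = W z w \<Longrightarrow> y v = y w"
proof -
  have *: "x z * y v \<le> x z * y w" "x v * y z \<le> x w * y z"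
    using x_pos[OF assms(1)] ypos[OF assms(1)] x_max[OF assms(2)] y_max[OF assms(2)]
    by (auto intro: mult_left_mono mult_right_mono)
  then show "W z v \<le> W z w" unfolding W_def by linarith
  assume "W z v = W z w"
  then have "x z * y v = x z * y w" using * unfolding W_def by linarith
  then show "y v = y w" using x_pos[OF assms(1)] by simp
qed

text \<open>An extra edge weighs less than any edge from \<open>s\<close> to \<open>U\<close>, because such an edge sees the
  large entry of \<open>s\<close> in \<open>y\<close>.\<close>

lemma W_extra_less_aux:
  assumes e: "(a, b) \<in> extra" and a: "a \<in> S" and u: "u \<in> U"
  shows "W a b < W s u"
proof -
  have uB: "u \<in> B" using U u by auto
  have ab: "(a, b) \<in> E" "b \<noteq> p a" using e a by (auto simp: extra_def arcs_of_iff)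
  have abV: "a \<in> V" "b \<in> V" using ab E_sub by auto
  have xs: "0 < x s" "x a \<le> x s" using x_pos V s_max a by auto
  show ?thesis
  proof (cases "b \<in> B")
    case True
    \<comment> \<open>Edges from \<open>s\<close> into \<open>B\<close> are either the parent edge
      or go to \<open>U1\<close>, and neither kind is extra.\<close>
    have "a \<noteq> s" using e ab True by (auto simp: extra_def arcs_of_iff U1_def)
    then have aP: "a \<in> P" using a by simp
    have bw: "b \<noteq> w" using ab p_w[OF a] by auto
    \<comment> \<open>The vertex \<open>a\<close> is pendent in the extremal graph, so
      \<open>m * y a\<close> is only \<open>y w\<close>, whereas \<open>m * y s\<close> contains
      both \<open>y w\<close> and \<open>y u\<close>.\<close>
    have "m * (x b * y a) \<le> x w * y w"
      using yP[OF aP] w_max[OF True] ypos[OF V(1)] by (simp add: mult.left_commute)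
    also have "\<dots> < x u * (y w + y u)" by (rule xU_yU[OF u])
    also have "\<dots> \<le> x u * (y w + sum y U)"
      using HS.finite_U u ypos V x_pos[of u] by (intro mult_left_mono add_left_mono member_le_sum) (auto intro: less_imp_le)
    also have "\<dots> = m * (x u * y s)" using ys by (simp add: mult.left_commute)
    finally have "x b * y a < x u * y s" using m_gt by simp
    moreover have "y b \<le> y u"
    proof (cases "b \<in> U")
      case True
      have "(m + 1) * (y w - y b) = (m + 1) * (y w - y u)"
        by (simp only: yU[OF True] yU[OF u])
      then show ?thesis using m_gt by simp
    next
      case False
      then show ?thesis using yB_less_U[of b u] \<open>b \<in> B\<close> bw u by simp
    qed
    then have "x a * y b \<le> x s * y u"
      using xs ypos[OF abV(2)] by (intro mult_mono) auto
    ultimately show ?thesis unfolding W_def by linarith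
  next
    case False
    then have bS: "b \<in> S" using abV V_eq by auto
    have "a \<noteq> b" using ab irrefl_E by (auto simp: irrefl_def)
    have yPs: "y z \<le> y s" and yPu: "y z \<le> y u" if "z \<in> P" for z
    proof -
      have "0 \<le> sum y U" using ypos[OF V(5)] by (intro sum_nonneg less_imp_le)
      then have "m * y z \<le> m * y s" using yP[OF that] ys by simp
      then show "y z \<le> y s" using m_gt by simp
      have "2 * (y w - y u) \<le> real (card B) * (y w - y u)"
        using yU_le[OF u] big by (intro mult_right_mono) auto
      then have "y w \<le> 2 * y u" using yU_ge[OF u] by simp
      moreover have "2 * y z \<le> m * y z"
        using m_gt ypos V that by (intro mult_right_mono) (auto intro: less_imp_le)
      ultimately show "y z \<le> y u" using yP[OF that] by simp
    qed
    have "x b \<le> x s" using s_max bS by simp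
    have "W a b \<le> x s * y b + x s * y a"
      unfolding W_def using xs \<open>x b \<le> x s\<close> ypos abV by (intro add_mono mult_right_mono) (auto intro: less_imp_le)
    also have "\<dots> = x s * (y a + y b)" by (simp add: algebra_simps)
    also have "\<dots> \<le> x s * (y s + y u)"
    proof -
      \<comment> \<open>At most one of the distinct ends is \<open>s\<close>; the other is pendent
        and has an entry no larger than \<open>y u\<close>.\<close>
      have "y a + y b \<le> y s + y u"
      proof (cases "a = s")
        case True
        then show ?thesis using yPu[of b] bS \<open>a \<noteq> b\<close> by simp
      next
        case False
        then have "y a \<le> y u" using yPu[of a] a by simp
        moreover have "y b \<le> y s" using yPs[of b] bS by (cases "b = s") auto
        ultimately show ?thesis by simp
      qed
      then show ?thesis using xs by (intro mult_left_mono) auto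
    qed
    also have "\<dots> < x u * y s + x s * y u"
      using xU_gt[OF uB] ypos[OF V(2)] by (simp add: algebra_simps)
    finally show ?thesis by (simp add: W_def algebra_simps)
  qed
qed

lemma W_extra_less:
  assumes "(a, b) \<in> extra" "u \<in> U"
  shows "W a b < W s u"
proof (cases "a \<in> S")
  case True
  then show ?thesis using W_extra_less_aux assms by simp
next
  case False
  then have "b \<in> S" using assms(1) by (auto simp: extra_def)
  then have "W b a < W s u" using W_extra_less_aux extra_sym assms by simp
  then show ?thesis by (simp add: W_def algebra_simps)
qed

lemma sum_extra: "(\<Sum>(u, v)\<in>extra. W u v) = 2 * (\<Sum>(u, v)\<in>extra. x u * y v)"
proof -
  have "(\<Sum>(u, v)\<in>extra. x v * y u) = (\<Sum>(u, v)\<in>extra. x u * y v)"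
    by (rule sum.reindex_bij_witness[of _ prod.swap prod.swap]) (auto intro: extra_sym)
  then show ?thesis by (simp add: W_def case_prod_unfold sum.distrib)
qed

text \<open>There are at most \<open>2 * card (U - U1)\<close> extra arcs, and each weighs less than
  the lightest edge from \<open>s\<close> to \<open>U - U1\<close>. The inequality is therefore
  strict unless \<open>U = U1\<close>, in which case the count leaves no extra arc.\<close>

lemma extra_le: "(\<Sum>(u, v)\<in>extra. W u v) \<le> 2 * (\<Sum>u\<in>U - U1. W s u)"
  and extra_eq: "(\<Sum>(u, v)\<in>extra. W u v) = 2 * (\<Sum>u\<in>U - U1. W s u) \<Longrightarrow> U = U1 \<and> extra = {}"
proof -
  have cd: "card (U - U1) = t - card U1"
    using U HS.finite_U finite_U1 by (simp add: card_Diff_subset)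
  have strict: "(\<Sum>(u, v)\<in>extra. W u v) < 2 * (\<Sum>u\<in>U - U1. W s u)" if ne: "U - U1 \<noteq> {}"
  proof (cases "extra = {}")
    case True
    have "0 < (\<Sum>u\<in>U - U1. W s u)"
      using HS.finite_U ne V by (intro sum_pos W_pos) auto
    then show ?thesis using True by simp
  next
    case False
    have "finite (U - U1)" using HS.finite_U by simp
    then obtain u0 where u0: "u0 \<in> U - U1" and "\<And>u. u \<in> U - U1 \<Longrightarrow> - W s u \<le> - W s u0"
      using finite_arg_max[OF _ ne, of "\<lambda>u. - W s u"] by blast
    then have min: "\<And>u. u \<in> U - U1 \<Longrightarrow> W s u0 \<le> W s u" by simp
    have "(\<Sum>(u, v)\<in>extra. W u v) < (\<Sum>e\<in>extra. W s u0)"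
      using False finite_extra u0 W_extra_less by (intro sum_strict_mono) auto
    also have "\<dots> = real (card extra) * W s u0" by simp
    also have "\<dots> \<le> real (2 * card (U - U1)) * W s u0"
    proof -
      have "card extra \<le> 2 * card (U - U1)" using card_extra cd by simp
      then have "real (card extra) \<le> real (2 * card (U - U1))" by (simp only: of_nat_le_iff)
      then show ?thesis using W_pos[of s u0] V u0 by (intro mult_right_mono) auto
    qed
    also have "\<dots> = 2 * (\<Sum>u\<in>U - U1. W s u0)" by simp
    also have "\<dots> \<le> 2 * (\<Sum>u\<in>U - U1. W s u)"
      using min by (intro mult_left_mono sum_mono) auto
    finally show ?thesis .
  qed
  have empty: "extra = {}" if "U - U1 = {}"
  proof -
    have "U = U1" using that U by auto
    then have "card extra = 0" using card_extra U(3) by simp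
    then show ?thesis using finite_extra by simp
  qed
  show "(\<Sum>(u, v)\<in>extra. W u v) \<le> 2 * (\<Sum>u\<in>U - U1. W s u)"
  proof (cases "U - U1 = {}")
    case True
    show ?thesis unfolding True empty[OF True] by simp
  next
    case False
    then show ?thesis using strict by simp
  qed
  assume "(\<Sum>(u, v)\<in>extra. W u v) = 2 * (\<Sum>u\<in>U - U1. W s u)"
  then have "U - U1 = {}" using strict by force
  then show "U = U1 \<and> extra = {}" using empty U(1) by auto
qed

lemma sum_H_decomp:
  "(\<Sum>(u, v)\<in>HS.H. x u * y v) = (\<Sum>(u, v)\<in>{(u, v). u \<in> B \<and> v \<in> B \<and> u \<noteq> v}. x u * y v)
    + (\<Sum>z\<in>S. W z w) + (\<Sum>u\<in>U. W s u)"
proof -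
  let ?B = "{(u, v). u \<in> B \<and> v \<in> B \<and> u \<noteq> v}"
  have eq: "HS.H = ?B \<union> arcs_of S (\<lambda>_. w) \<union> arcs_of U (\<lambda>_. s)"
    using H_arcs_eq_arcs_of[of B w U s P] s by (simp add: insert_absorb)
  have fin: "finite ?B" "finite (arcs_of S (\<lambda>_. w))" "finite (arcs_of U (\<lambda>_. s))"
    using finite_BS HS.finite_U finite_subset[of ?B "B \<times> B"] by (auto simp: arcs_of_def)
  have d: "?B \<inter> arcs_of S (\<lambda>_. w) = {}" "(?B \<union> arcs_of S (\<lambda>_. w)) \<inter> arcs_of U (\<lambda>_. s) = {}"
    using BS U s w by (auto simp: arcs_of_iff)
  have 1: "(\<Sum>(u, v)\<in>arcs_of S (\<lambda>_. w). x u * y v) = (\<Sum>z\<in>S. W z w)"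
    using finite_BS w BS by (subst sum_arcs_of) (auto simp: W_def)
  have 2: "(\<Sum>(u, v)\<in>arcs_of U (\<lambda>_. s). x u * y v) = (\<Sum>u\<in>U. W s u)"
    using HS.finite_U s U BS by (subst sum_arcs_of) (auto simp: W_def add.commute)
  show ?thesis
    using fin d by (subst eq) (simp add: sum.union_disjoint 1 2)
qed

text \<open>The clique \<open>B\<close> and the edges from \<open>s\<close> to \<open>U1\<close>
  cancel. The sum of \<open>W\<close> over \<open>extra\<close> meets each edge as two arcs, hence
  the division by 2.\<close>

lemma form_diff:
  "(\<Sum>(u, v)\<in>HS.H. x u * y v) - (\<Sum>(u, v)\<in>E. x u * y v)
    = (\<Sum>z\<in>S. W z w - W z (p z)) + ((\<Sum>u\<in>U - U1. W s u) - (\<Sum>(u, v)\<in>extra. W u v) / 2)"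
proof -
  have "(\<Sum>u\<in>U. W s u) = (\<Sum>u\<in>U - U1. W s u) + (\<Sum>u\<in>U1. W s u)"
    using U(1) HS.finite_U by (rule sum.subset_diff)
  moreover have "(\<Sum>u\<in>U1. x u * y s + x s * y u) = (\<Sum>u\<in>U1. W s u)"
    by (simp add: W_def add.commute)
  moreover have "(\<Sum>z\<in>S. x z * y (p z) + x (p z) * y z) = (\<Sum>z\<in>S. W z (p z))"
    by (simp add: W_def)
  ultimately show ?thesis
    by (simp add: sum_H_decomp sum_E_decomp sum_extra sum_subtractf)
qed

lemma pV: "z \<in> S \<Longrightarrow> p z \<in> V"
  using p_arc E_sub by auto

lemma sum_parent_nonneg: "0 \<le> (\<Sum>z\<in>S. W z w - W z (p z))"
  using W_le_w(1) V pV by (intro sum_nonneg) auto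

lemma form_le: "(\<Sum>(u, v)\<in>E. x u * y v) \<le> (\<Sum>(u, v)\<in>HS.H. x u * y v)"
  using form_diff sum_parent_nonneg extra_le by simp

text \<open>Equality makes every comparison tight: no extra edge remains, and each parent attains
  the value \<open>y w\<close>. What is left is to see that each parent is \<open>w\<close>
  itself.\<close>

lemma form_eq:
  assumes "(\<Sum>(u, v)\<in>E. x u * y v) = (\<Sum>(u, v)\<in>HS.H. x u * y v)"
  shows "E = HS.H"
proof -
  have "(\<Sum>(u, v)\<in>extra. W u v) = 2 * (\<Sum>u\<in>U - U1. W s u)"
    and zero: "(\<Sum>z\<in>S. W z w - W z (p z)) = 0"
    using assms form_diff sum_parent_nonneg extra_le by linarith+
  then have UU: "U = U1" "extra = {}" using extra_eq by auto
  have "W z w - W z (p z) = 0" if "z \<in> S" for z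
    using zero that W_le_w(1) V pV finite_BS by (subst (asm) sum_nonneg_eq_0_iff) auto
  then have yp: "y (p z) = y w" if "z \<in> S" for z
    using W_le_w(2)[of z "p z"] that V pV by simp
  have "p z = w" if z: "z \<in> S" for z
  proof (rule ccontr)
    assume ne: "p z \<noteq> w"
    have "p z \<notin> S" using yS_less[of "p z"] yp[OF z] by auto
    moreover have "p z \<notin> B - U - {w}" using yB_less[of "p z"] yp[OF z] by auto
    ultimately have pU: "p z \<in> U" using pV[OF z] V_eq ne by auto
    \<comment> \<open>A vertex of \<open>U\<close> attains \<open>y w\<close> only when there are no
      pendent vertices. Then \<open>z\<close> is \<open>s\<close>, whose parent was excluded from
      \<open>U1\<close>.\<close>
    then have "sum y P = 0" using yU[OF pU] yp[OF z] by simp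
    then have "P = {}" using finite_BS ypos V
      by (metis DiffD1 finite_Diff less_irrefl sum_pos)
    then have "z = s" using z by auto
    then show False using pU UU by (simp add: U1_def)
  qed
  then have "arcs_of S p = arcs_of S (\<lambda>_. w)" by (auto simp: arcs_of_iff)
  then show ?thesis
    using E_decomp UU H_arcs_eq_arcs_of[of B w U s P] s by (simp add: insert_absorb)
qed

lemma radius_le: "radius \<le> HS.rhoH" and radius_eq: "radius = HS.rhoH \<Longrightarrow> E = HS.H"
proof -
  interpret H: connected_graph V HS.H
    using HS.connected_H by (simp only: VH_eq)
  have yV: "perron V HS.H HS.rhoH y" using y' by (simp only: VH_eq)
  have d: "(HS.rhoH - radius) * (\<Sum>v\<in>V. x v * y v)
      = (\<Sum>(u, v)\<in>HS.H. x u * y v) - (\<Sum>(u, v)\<in>E. x u * y v)"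
    by (rule rho_diff_form[OF sym_graph_axioms H.sym_graph_axioms x yV])
  moreover have "0 < (\<Sum>v\<in>V. x v * y v)"
    using finite_V V_ne x_pos ypos by (intro sum_pos) auto
  ultimately show "radius \<le> HS.rhoH"
    using form_le by (smt (verit) mult_neg_pos)
  show "E = HS.H" if "radius = HS.rhoH"
    using d that form_eq by simp
qed

end

section \<open>The extremal bound and its equality case\<close>

lemma (in clique_graph) clique_graph_extremal:
  obtains w U s where "H_shape B w U s (S - {s})" "card U = t" "s \<in> S"
    "radius \<le> rho \<lparr>pverts = V, parcs = H_arcs B w U s (S - {s})\<rparr>"
    "radius = rho \<lparr>pverts = V, parcs = H_arcs B w U s (S - {s})\<rparr> \<Longrightarrow> E = H_arcs B w U s (S - {s})"
proof -
  obtain x where x: "perron V E radius x" by (rule perron_exists)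
  obtain w where w: "w \<in> B" "\<And>b. b \<in> B \<Longrightarrow> x b \<le> x w"
    using finite_arg_max[OF finite_BS(1) B_ne, of x] by blast
  obtain s where s: "s \<in> S" "\<And>z. z \<in> S \<Longrightarrow> x z \<le> x s"
    using finite_arg_max[OF finite_BS(2) S_ne, of x] by blast
  have wV: "w \<in> V" and SV: "S \<subseteq> V - {w}" using w(1) V_eq BS by auto
  obtain p where p: "\<And>v. v \<in> V - {w} \<Longrightarrow> (v, p v) \<in> E"
    "\<And>v. v \<in> V - {w} \<Longrightarrow> (v, w) \<in> E \<Longrightarrow> p v = w"
    "\<And>v. v \<in> V - {w} \<Longrightarrow> p v \<noteq> w \<Longrightarrow> p (p v) \<noteq> v"
    using parent_function[OF wV] by metis
  interpret C: clique_parent V E B S t x w s p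
    by unfold_locales (use x w s p SV in \<open>auto simp: subset_iff\<close>)
  \<comment> \<open>There is room to enlarge \<open>U1\<close> to a set of exactly \<open>t\<close>
    vertices avoiding \<open>w\<close>.\<close>
  have "card (B - {w}) = card B - 1" using w(1) finite_BS by simp
  then have "t \<le> card (B - {w})" using big by simp
  moreover have "card C.U1 \<le> t" using C.card_extra by simp
  ultimately obtain U where U: "C.U1 \<subseteq> U" "U \<subseteq> B - {w}" "card U = t"
    using exists_subset_between[OF _ _ C.U1_sub] finite_BS by (metis finite_Diff)
  interpret HS: H_shape B w U s "S - {s}"
    using finite_BS w(1) U(2) s(1) BS by unfold_locales auto
  obtain y where "perron HS.VH HS.H HS.rhoH y"
    by (rule connected_graph.perron_exists[OF HS.connected_H])
  then interpret D: clique_choice V E B S t x w s p U y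
    using U by unfold_locales (simp_all add: HS.VH_def)
  show ?thesis
    using that[OF HS.H_shape_axioms U(3) s(1)] D.radius_le D.radius_eq
    by (simp only: D.VH_eq)
qed

text \<open>Completing \<open>B\<close> to a clique leaves the arcs meeting \<open>S\<close>
  unchanged and strictly raises the radius if any arc was missing; equality thus forces
  \<open>B\<close> to be a clique already.\<close>

lemma rho_le_extremal:
  assumes "connected_graph V E" "irrefl E" "V = B \<union> S" "B \<inter> S = {}" "S \<noteq> {}"
    and few: "card {(u, v) \<in> E. u \<in> S \<or> v \<in> S} \<le> 2 * (card S + t)"
    and "card S + 2 * t + 2 \<le> card B"
  obtains w U s where "H_shape B w U s (S - {s})" "card U = t" "s \<in> S"
    "rho \<lparr>pverts = V, parcs = E\<rparr> \<le> rho \<lparr>pverts = V, parcs = H_arcs B w U s (S - {s})\<rparr>"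
    "rho \<lparr>pverts = V, parcs = E\<rparr> = rho \<lparr>pverts = V, parcs = H_arcs B w U s (S - {s})\<rparr>
      \<Longrightarrow> E = H_arcs B w U s (S - {s})"
proof -
  interpret connected_graph V E by fact
  define E' where "E' = E \<union> {(u, v). u \<in> B \<and> v \<in> B \<and> u \<noteq> v}"
  have E': "connected_graph V E'"
  proof
    show "finite V" "V \<noteq> {}" by (rule finite_V, rule V_ne)
    show "E' \<subseteq> V \<times> V" using E_sub assms(3) by (auto simp: E'_def)
    show "sym E'" using E_symD by (auto simp: E'_def intro!: symI)
    fix u v assume "u \<in> V" "v \<in> V"
    then have "(u, v) \<in> E\<^sup>*" by (rule conn)
    then show "(u, v) \<in> E'\<^sup>*" using rtrancl_mono[of E E'] by (auto simp: E'_def)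
  qed
  have eq: "{(u, v) \<in> E'. u \<in> S \<or> v \<in> S} = {(u, v) \<in> E. u \<in> S \<or> v \<in> S}"
    using assms(4) by (auto simp: E'_def)
  interpret C: clique_graph V E' B S t
  proof (intro clique_graph.intro clique_graph_axioms.intro E')
    show "irrefl E'" using assms(2) by (auto simp: E'_def irrefl_def)
    show "card {(u, v) \<in> E'. u \<in> S \<or> v \<in> S} \<le> 2 * (card S + t)"
      unfolding eq by (rule few)
  qed (use assms in \<open>auto simp: E'_def\<close>)
  obtain w U s where *: "H_shape B w U s (S - {s})" "card U = t" "s \<in> S"
    "C.radius \<le> rho \<lparr>pverts = V, parcs = H_arcs B w U s (S - {s})\<rparr>"
    "C.radius = rho \<lparr>pverts = V, parcs = H_arcs B w U s (S - {s})\<rparr> \<Longrightarrow> E' = H_arcs B w U s (S - {s})"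
    by (rule C.clique_graph_extremal) blast
  have "E = E' \<or> radius < C.radius"
    using rho_strict_mono[OF assms(1) E'] by (auto simp: E'_def)
  then show ?thesis using that[OF *(1-3)] *(4,5) by fastforce
qed

lemma pair_pre_digraph_eta: "\<lparr>pverts = pverts G, parcs = parcs G\<rparr> = G"
  by simp

theorem theorem1p3:
  fixes G :: "'a pair_pre_digraph" and l n :: nat
  assumes "l \<ge> 2"
    and "pair_graph G"
    and "Digraph_Component.connected (with_proj G)"
    and "card (pverts G) = n"
    and "n \<ge> 2 * edge_connectivity l G + 2"
    and "edge_connectivity l G \<ge> l - 1"
  shows "rho G \<le> rho (H_graph (edge_connectivity l G) l n) \<and>
    (rho G = rho (H_graph (edge_connectivity l G) l n) \<longleftrightarrow>
      digraph_iso (with_proj G) (with_proj (H_graph (edge_connectivity l G) l n)))"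
proof -
  define a where "a = edge_connectivity l G"
  let ?H = "H_graph a l n"
  interpret G: pair_graph G by fact
  interpret connected_graph "pverts G" "parcs G"
    using connected_graph_of_pair_graph(1) assms(2,3) by blast
  have irr: "irrefl (parcs G)"
    using connected_graph_of_pair_graph(2) assms(2,3) by blast
  have rad: "radius = rho G" by (simp only: pair_pre_digraph_eta)
  have l: "2 \<le> l" "l \<le> a + 1" "a < n" "2 * a + 2 \<le> n" "l \<le> n"
    using assms(1,5,6) by (simp_all add: a_def)
  note Hs = H_graph_shape[OF l(1-3)]
  interpret HG: H_shape "{0..<a + 2 - l} \<union> {a + 3 - l..<n + 2 - l}" 0 "{1..<a + 2 - l}"
    "a + 2 - l" "{n + 2 - l..<n}"
    by (rule Hs(1))
  have HG_eq: "\<lparr>pverts = HG.VH, parcs = HG.H\<rparr> = ?H"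
    by (simp only: HG.VH_def Hs(2))
  have iso_imp: "rho ?H = rho G" if "digraph_iso (with_proj G) (with_proj ?H)"
    using rho_iso_eq[OF G.pair_finite_verts _ that] G.pair_wf_digraph by blast
  obtain c where c: "c ` pverts G = {..<l}" "card {(u, v) \<in> parcs G. c u \<noteq> c v} \<le> 2 * a"
    using edge_connectivity_partition[OF assms(2), of l] l assms(4) by (auto simp: a_def)
  have "rho G \<le> rho ?H \<and> (rho G = rho ?H \<longrightarrow> digraph_iso (with_proj G) (with_proj ?H))"
  proof (cases "\<forall>i. card {v \<in> pverts G. c v = i} \<le> n - l")
    case True
    have "radius < real (n - l)"
    proof (rule radius_less_of_small_classes[OF irr c(1) _ _ c(2)])
      show "card {v \<in> pverts G. c v = i} \<le> n - l" for i using True by simp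
    qed (use l assms(4) in auto)
    \<comment> \<open>The clique of the extremal graph has \<open>n + 1 - l\<close> vertices. The
      strict inequality rules out equality in this case.\<close>
    also have "real (n - l) \<le> rho ?H"
      using HG.rhoH_ge l(5) unfolding HG_eq Hs(3) by (simp add: of_nat_diff)
    finally show ?thesis by (simp add: rad)
  next
    case False
    then obtain i where i: "n - l < card {v \<in> pverts G. c v = i}" by (auto simp: not_le)
    define B where "B = {v \<in> pverts G. c v = i}"
    define S where "S = pverts G - B"
    have fin: "finite B" "finite S" using finite_V by (simp_all add: B_def S_def)
    have VBS: "pverts G = B \<union> S" "B \<inter> S = {}" by (auto simp: B_def S_def)
    have cS: "c ` S = {..<l} - {i}"
      unfolding c(1)[symmetric] by (auto simp: S_def B_def)
    have "B \<noteq> {}" using i by (auto simp flip: B_def)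
    then have "i < l" using c(1) by (auto simp: B_def)
    then have "card (c ` S) = l - 1" using cS by simp
    moreover have "card (c ` S) \<le> card S" using fin by (intro card_image_le)
    moreover have "card B + card S = n"
      using VBS fin assms(4) by (simp add: card_Un_disjoint)
    \<comment> \<open>The other \<open>l - 1\<close> classes are nonempty, and \<open>B\<close>
      leaves them fewer than \<open>l\<close> vertices in all. Hence each of them is a single
      vertex.\<close>
    ultimately have cards: "card S = l - 1" "card B = n + 1 - l" "card (c ` S) = card S"
      using i l by (auto simp flip: B_def)
    then have inj: "inj_on c S" using fin by (intro eq_card_imp_inj_on) auto
    \<comment> \<open>Since the classes in \<open>S\<close> are singletons, every edge meeting
      \<open>S\<close> runs between classes.\<close>
    have "{(u, v) \<in> parcs G. u \<in> S \<or> v \<in> S} \<subseteq> {(u, v) \<in> parcs G. c u \<noteq> c v}"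
    proof (clarsimp)
      fix u v assume e: "(u, v) \<in> parcs G" "u \<in> S \<or> v \<in> S" "c u = c v"
      then have "u \<in> S" "v \<in> S" using E_sub by (auto simp: S_def B_def)
      then have "u = v" using inj e(3) by (simp add: inj_on_def)
      then show False using e(1) irr by (simp add: irrefl_def)
    qed
    then have "card {(u, v) \<in> parcs G. u \<in> S \<or> v \<in> S} \<le> card {(u, v) \<in> parcs G. c u \<noteq> c v}"
      by (rule card_mono[rotated]) (rule finite_subset[OF _ finite_E], blast)
    \<comment> \<open>The parameter \<open>t\<close> is \<open>a + 1 - l\<close>, so that
      \<open>card S + t\<close> equals \<open>a\<close>. The next bound is then a restatement of
      \<open>2 * a + 2 \<le> n\<close>.\<close>
    then have few: "card {(u, v) \<in> parcs G. u \<in> S \<or> v \<in> S} \<le> 2 * (card S + (a + 1 - l))"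
      using c(2) cards l by simp
    have big: "card S + 2 * (a + 1 - l) + 2 \<le> card B" using cards l by simp
    have S_ne: "S \<noteq> {}" using cards l by auto
    obtain w U s where *: "H_shape B w U s (S - {s})" "card U = a + 1 - l" "s \<in> S"
      "radius \<le> rho \<lparr>pverts = pverts G, parcs = H_arcs B w U s (S - {s})\<rparr>"
      "radius = rho \<lparr>pverts = pverts G, parcs = H_arcs B w U s (S - {s})\<rparr>
        \<Longrightarrow> parcs G = H_arcs B w U s (S - {s})"
      by (rule rho_le_extremal[OF connected_graph_axioms irr VBS S_ne few big]) blast
    let ?G' = "\<lparr>pverts = pverts G, parcs = H_arcs B w U s (S - {s})\<rparr>"
    interpret HS: H_shape B w U s "S - {s}" by (rule *(1))
    have VG: "B \<union> insert s (S - {s}) = pverts G" using VBS(1) *(3) by auto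
    have "card (S - {s}) = l - 2" using cards *(3) fin by simp
    then have iso: "digraph_iso (with_proj ?G') (with_proj ?H)"
      using H_shape_iso[OF *(1) Hs(1)] unfolding Hs VG by (simp add: cards *(2))
    have "pair_wf_digraph ?G'"
      unfolding HS.H_arcs_colour HS.VH_def VG by unfold_locales auto
    then have "rho ?H = rho ?G'"
      using rho_iso_eq[of ?G', OF _ _ iso] finite_V by simp
    moreover have "G = ?G'" if "rho G = rho ?G'"
    proof -
      have "parcs G = H_arcs B w U s (S - {s})" using *(5) that by (simp only: rad)
      then show ?thesis by (metis pair_pre_digraph_eta)
    qed
    ultimately show ?thesis using *(4) iso unfolding rad by metis
  qed
  then show ?thesis using iso_imp unfolding a_def by metis
qed

end
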